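(* Let $2<p<\infty$. There exists a constant $C_p>0$, depending only on $p$, such that for every integer $N>10$ and every weight $w$ on $\mathbb{R}^2$, with $W=\mathfrak{M}_{\Sigma_N}\mathfrak{M}_{\mathcal{Q}}w$ (i.e. $W=\mathfrak{M}_{\Sigma_N}(\mathfrak{M}_{\mathcal{Q}}w)$), $$ \|\mathfrak{M}_{\Sigma_N}f\|_{L^p(\mathbb{R}^2,w)}\le C_p(\log N)^{1/p}\,\|f\|_{L^p(\mathbb{R}^2,W)} $$ holds for all $f\in L^p(\mathbb{R}^2,W)$.
   Context: A weight on $\mathbb{R}^2$ is a non-negative locally integrable function on $\mathbb{R}^2$. $|E|$ is the Lebesgue measure of $E$ and $\mathbf{1}_E$ its characteristic function. For $0<p<\infty$, $L^p(\mathbb{R}^2,w)$ is the weighted Lebesgue space with $$\|f\|_{L^p(\mathbb{R}^2,w)}=\left(\int_{\mathbb{R}^2}|f(x)|^p w(x)\,dx\right)^{1/p},$$ and similarly with $W$ in place of $w$. $\mathcal{Q}$ is the set of all cubes (squares) in $\mathbb{R}^2$, with sides not necessarily parallel to the axes. The Hardy-Littlewood maximal operator is $$\mathfrak{M}_{\mathcal{Q}}f(x)=\sup_{Q\in\mathcal{Q}}\mathbf{1}_Q(x)\frac{1}{|Q|}\int_Q|f(y)|\,dy .$$ For a set $\Sigma\subset S^1$ of unit vectors in $\mathbb{R}^2$, $\mathcal{B}_{\Sigma}$ is the set of all rectangles in $\mathbb{R}^2$ whose longest side is parallel to some vector in $\Sigma$, and the directional maximal operator associated with $\Sigma$ is $$\mathfrak{M}_{\Sigma}f(x)=\sup_{R\in\mathcal{B}_{\Sigma}}\mathbf{1}_R(x)\frac{1}{|R|}\int_R|f(y)|\,dy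 .$$ For an integer $N$, $$\Sigma_N=\left\{\left(\cos\frac{2\pi j}{N},\ \sin\frac{2\pi j}{N}\right):\ j=0,1,\ldots,N-1\right\}$$ is the set of $N$ uniformly spread directions on the circle. The formulas for the maximal operators are used for arbitrary measurable functions (e.g. $\mathfrak{M}_{\mathcal{Q}}w$, with values in $[0,\infty]$); integrals of non-negative functions take values in $[0,\infty]$, with the convention $0\cdot\infty=0$. *)

theory Defs
  imports "HOL-Analysis.Analysis"
begin

definition weight :: "(real^2 \<Rightarrow> real) \<Rightarrow> bool" where
  "weight w \<longleftrightarrow> (\<forall>x. 0 \<le> w x) \<and> (\<forall>K. compact K \<longrightarrow> set_integrable lebesgue K w)"

text \<open>The closed rectangle with corner \<open>a\<close> and sides \<open>u\<close>, \<open>v\<close>. It is a non-degenerate rectangle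
  when \<open>u\<close> and \<open>v\<close> are nonzero and orthogonal.\<close>
definition rectangle :: "real^2 \<Rightarrow> real^2 \<Rightarrow> real^2 \<Rightarrow> (real^2) set" where
  "rectangle a u v = {a + s *\<^sub>R u + t *\<^sub>R v | s t. s \<in> {0..1} \<and> t \<in> {0..1}}"

definition squares :: "(real^2) set set" where
  "squares = {rectangle a u v | a u v. u \<noteq> 0 \<and> v \<noteq> 0 \<and> u \<bullet> v = 0 \<and> norm u = norm v}"

text \<open>Rectangles whose longest side \<open>u\<close> is parallel to a vector of \<open>\<Sigma>\<close>. For a square,
  each side counts as a longest side.\<close>
definition directional_rectangles :: "(real^2) set \<Rightarrow> (real^2) set set" where
  "directional_rectangles \<Sigma> = {rectangle a u v | a u v.
     u \<noteq> 0 \<and> v \<noteq> 0 \<and> u \<bullet> v = 0 \<and> norm v \<le> norm u \<and> (\<exists>\<sigma>\<in>\<Sigma>. \<exists>k. u = k *\<^sub>R \<sigma>)}"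

text \<open>The argument \<open>g\<close> stands for the absolute value of the function to which the operator
  is applied. It is \<open>ennreal\<close>-valued so that maximal operators can be iterated.\<close>
definition maximal_operator :: "(real^2) set set \<Rightarrow> (real^2 \<Rightarrow> ennreal) \<Rightarrow> real^2 \<Rightarrow> ennreal" where
  "maximal_operator \<B> g x =
     (SUP R\<in>\<B>. indicator R x * ((\<integral>\<^sup>+y\<in>R. g y \<partial>lebesgue) / emeasure lebesgue R))"

definition hl_maximal :: "(real^2 \<Rightarrow> ennreal) \<Rightarrow> real^2 \<Rightarrow> ennreal" where
  "hl_maximal = maximal_operator squares"

definition directional_maximal ::
    "(real^2) set \<Rightarrow> (real^2 \<Rightarrow> ennreal) \<Rightarrow> real^2 \<Rightarrow> ennreal" where
  "directional_maximal \<Sigma> = maximal_operator (directional_rectangles \<Sigma>)"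

definition uniform_directions :: "nat \<Rightarrow> (real^2) set" where
  "uniform_directions N =
     {vector [cos (2 * pi * real j / real N), sin (2 * pi * real j / real N)] | j. j < N}"

text \<open>Meant for positive exponents only.\<close>
definition ennreal_powr :: "ennreal \<Rightarrow> real \<Rightarrow> ennreal" where
  "ennreal_powr x p = (if x = \<infinity> then \<infinity> else ennreal (enn2real x powr p))"

text \<open>The norm of a function with absolute value \<open>g\<close> in \<open>L\<^sup>p\<close> with respect to \<open>w\<close>; both are
  \<open>ennreal\<close>-valued because \<open>g\<close> and \<open>w\<close> may be maximal functions.\<close>
definition weighted_Lp_norm :: "real \<Rightarrow> (real^2 \<Rightarrow> ennreal) \<Rightarrow> (real^2 \<Rightarrow> ennreal) \<Rightarrow> ennreal" where
  "weighted_Lp_norm p w g =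
     ennreal_powr (\<integral>\<^sup>+x. ennreal_powr (g x) p * w x \<partial>lebesgue) (1 / p)"

definition weighted_Lp :: "real \<Rightarrow> (real^2 \<Rightarrow> ennreal) \<Rightarrow> (real^2 \<Rightarrow> complex) set" where
  "weighted_Lp p w = {f. f \<in> borel_measurable lebesgue \<and>
     weighted_Lp_norm p w (\<lambda>x. ennreal (cmod (f x))) < \<infinity>}"

end

(* By the layer cake formula and p > 2 it suffices to prove the weak type (2,2) bound
     L^2 w({M g > L}) <= C log N * int g^2 W,
   applied at height L to the part of g above L/2.

   Cover {M g > L} by finitely many rectangles on which g has average larger than L and go through
   them in order of decreasing length, keeping R_k if the total overlap of R_k with the rectangles
   kept before is at most T |R_k|, where T ~ log N counts the relevant dyadic scales. Let F be the sum
   of the indicators of the threefold dilates R* of the kept rectangles.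

   - The overlap of a rejected rectangle R with a longer R' is, up to a factor |R| / rho^2, the mass of
     1_{R'*} in the ball of radius ~ rho around any point of R. Here rho = max(width, |sin| length) is
     determined by R and the angle between the two, and takes only ~ log N values up to factors of 2,
     because that angle is 0 or at least ~ 1/N. By pigeonhole some ball around each point of the union
     carries F-mass comparable to its area.
   - Hence, by Vitali, the w-measure of the union is at most C int F M_Q w = C sum |R*| v_R, where v_R is
     the mean of M_Q w over R*, so that v_R <= W on R.
   - The selection rule bounds the overlaps, so Cauchy-Schwarz in the form of a duality argument bounds
     sum v_R |R| by C T L^(-2) int g^2 W. *)
theory Submission
  imports Defs
begin

text \<open>An arbitrary weight need not be doubling, so \<open>w\<close>-measures of overlapping
  rectangles cannot be compared with each other. All overlaps are therefore Lebesgue areas, and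
  \<open>w\<close> enters in only two places: balls carrying enough mass of F replace
  \<open>w\<close> by M_Q w, and the means of M_Q w over the dilates are then bounded by the
  directional operator. This is where the two operators in W and their order come from. Decreasing
  length matters because the scale rho has to be read off the rejected rectangle and an angle alone.
  A longer rectangle looks like a strip near the rejected one, whatever its own length is. Thus the
  number of scales counts, and not the number of rectangles or directions. Finiteness of the family
  makes the ordering by length possible, and it keeps the weighted sum finite, so that the duality
  argument can absorb half of it. The passage to p is interpolation with the trivial bound on
  bounded functions: cutting off g below L/2 lowers every mean by at most L/2.\<close>

section \<open>Rectangles in orthonormal coordinates and areas of parallelograms\<close>

definition perp :: "real^2 \<Rightarrow> real^2" where
  "perp e = vector [- e $ 2, e $ 1]"

text \<open>\<open>A\<close> and \<open>B\<close> are half side lengths about the centre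
  \<open>c\<close>. Concentric dilation only scales these two numbers, and membership is a pair of
  strip conditions.\<close>

definition orect :: "real^2 \<Rightarrow> real^2 \<Rightarrow> real \<Rightarrow> real \<Rightarrow> (real^2) set" where
  "orect e c A B = {y. \<bar>(y - c) \<bullet> e\<bar> \<le> A \<and> \<bar>(y - c) \<bullet> perp e\<bar> \<le> B}"

lemma perp_nth [simp]: "perp e $ 1 = - e $ 2" "perp e $ 2 = e $ 1"
  by (simp_all add: perp_def)

lemma inner_vec2: "x \<bullet> y = x $ 1 * y $ 1 + x $ 2 * y $ 2" for x y :: "real^2"
  by (simp add: inner_vec_def sum_2)

lemma vec2_eq_iff: "x = y \<longleftrightarrow> x $ 1 = y $ 1 \<and> x $ 2 = y $ 2" for x y :: "real^2"
  by (simp add: vec_eq_iff forall_2)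

lemma perp_inner_self [simp]: "e \<bullet> perp e = 0" "perp e \<bullet> e = 0"
  by (simp_all add: inner_vec2)

lemma perp_inner_perp [simp]: "perp e \<bullet> perp f = e \<bullet> f"
  by (simp add: inner_vec2)

lemma norm_perp [simp]: "norm (perp e) = norm e"
  by (simp add: norm_eq_sqrt_inner)

lemma orthonormal_inner_expand:
  fixes e x y :: "real^2"
  assumes "norm e = 1"
  shows "x \<bullet> y = (x \<bullet> e) * (y \<bullet> e) + (x \<bullet> perp e) * (y \<bullet> perp e)"
proof -
  have e: "e $ 1 * e $ 1 + e $ 2 * e $ 2 = 1"
    using assms by (simp add: norm_eq_sqrt_inner inner_vec2)
  have "(x \<bullet> e) * (y \<bullet> e) + (x \<bullet> perp e) * (y \<bullet> perp e)
      = (e $ 1 * e $ 1 + e $ 2 * e $ 2) * (x \<bullet> y)"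
    by (simp add: inner_vec2 algebra_simps)
  then show ?thesis using e by simp
qed

lemma orthonormal_norm_expand:
  fixes e x :: "real^2"
  assumes "norm e = 1"
  shows "(norm x)\<^sup>2 = (x \<bullet> e)\<^sup>2 + (x \<bullet> perp e)\<^sup>2"
  unfolding power2_norm_eq_inner unfolding power2_eq_square by (rule orthonormal_inner_expand[OF assms])

text \<open>The linear map \<open>T\<close> with coordinates \<open>y \<bullet> e\<close> and
  \<open>y \<bullet> f\<close> sends \<open>P\<close> to a box, and its determinant is
  \<open>e \<bullet> perp f\<close> up to sign. For unit vectors this number is the sine of the
  angle between them. The inverse \<open>S\<close> is written out so that \<open>P\<close> appears
  as a linear image.\<close>

lemma measure_parallelogram:
  fixes e f :: "real^2" and a b :: real
  assumes D: "e \<bullet> perp f \<noteq> 0" and A: "0 \<le> A" and B: "0 \<le> B"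
  defines "P \<equiv> {y. a \<le> y \<bullet> e \<and> y \<bullet> e \<le> a + A \<and> b \<le> y \<bullet> f \<and> y \<bullet> f \<le> b + B}"
  shows "P \<in> lmeasurable" "measure lebesgue P = A * B / \<bar>e \<bullet> perp f\<bar>"
proof -
  define T :: "real^2 \<Rightarrow> real^2" where "T y = vector [y \<bullet> e, y \<bullet> f]" for y
  define D where "D = e $ 1 * f $ 2 - e $ 2 * f $ 1"
  define S :: "real^2 \<Rightarrow> real^2" where
    "S z = vector [(z $ 1 * f $ 2 - z $ 2 * e $ 2) / D, (z $ 2 * e $ 1 - z $ 1 * f $ 1) / D]" for z
  have D0: "D \<noteq> 0" using D by (simp add: D_def inner_vec2)
  have DD: "\<bar>e \<bullet> perp f\<bar> = \<bar>D\<bar>" by (simp add: D_def inner_vec2)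
  have lin: "linear S"
    by (rule linearI; simp add: S_def vec2_eq_iff; use D0 in \<open>simp add: field_simps\<close>)
  have TS: "T (S z) = z" for z
    unfolding vec2_eq_iff T_def S_def inner_vec2 using D0
    by (simp add: D_def divide_simps) (simp add: algebra_simps)
  have ST: "S (T y) = y" for y
    unfolding vec2_eq_iff T_def S_def inner_vec2 using D0
    by (simp add: D_def divide_simps) (simp add: algebra_simps)
  define K :: "(real^2) set" where "K = cbox (vector [a, b]) (vector [a + A, b + B])"
  have P: "P = S ` K"
  proof
    show "P \<subseteq> S ` K"
    proof
      fix y assume "y \<in> P"
      then have "T y \<in> K" by (simp add: P_def K_def T_def mem_box_cart forall_2)
      then show "y \<in> S ` K" using ST[of y] by force
    qed
    show "S ` K \<subseteq> P"
    proof
      fix y assume "y \<in> S ` K"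
      then obtain z where z: "z \<in> K" "y = S z" by auto
      then have "T y \<in> K" using TS by simp
      then show "y \<in> P" by (simp add: P_def K_def T_def mem_box_cart forall_2)
    qed
  qed
  have K: "K \<in> lmeasurable" by (simp add: K_def)
  show "P \<in> lmeasurable" unfolding P using measurable_linear_image[OF lin K] .
  have ne: "cbox (vector [a, b]) (vector [a + A, b + B] :: real^2) \<noteq> {}"
    using A B by (auto simp: mem_box_cart forall_2 simp flip: ex_in_conv intro!: exI[of _ "vector [a, b]"])
  have mK: "measure lebesgue K = A * B"
    unfolding K_def using A B
    by (simp add: content_cbox_cart[OF ne] UNIV_2)
  have "det (matrix S) = (f $ 2 * e $ 1) / (D * D) - (e $ 2 * f $ 1) / (D * D)"
    by (simp add: det_2 matrix_def S_def axis_def)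
  also have "\<dots> = D / (D * D)"
    by (simp only: diff_divide_distrib[symmetric]) (simp add: D_def mult.commute)
  also have "\<dots> = 1 / D" by simp
  finally have dS: "det (matrix S) = 1 / D" .
  show "measure lebesgue P = A * B / \<bar>e \<bullet> perp f\<bar>"
    unfolding P measure_linear_image[OF lin K] mK dS DD by simp
qed

lemma parallelogram_shift:
  "{y. \<bar>(y - c) \<bullet> e\<bar> \<le> A \<and> \<bar>(y - d) \<bullet> f\<bar> \<le> B} =
   {y. c \<bullet> e - A \<le> y \<bullet> e \<and> y \<bullet> e \<le> (c \<bullet> e - A) + 2 * A \<and>
       d \<bullet> f - B \<le> y \<bullet> f \<and> y \<bullet> f \<le> (d \<bullet> f - B) + 2 * B}" for e f c d :: "real^2"
  by (auto simp: inner_diff_left abs_le_iff)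

lemma measure_strip_inter:
  fixes e f c d :: "real^2"
  assumes "e \<bullet> perp f \<noteq> 0" "0 \<le> A" "0 \<le> B"
  shows "{y. \<bar>(y - c) \<bullet> e\<bar> \<le> A \<and> \<bar>(y - d) \<bullet> f\<bar> \<le> B} \<in> lmeasurable"
    "measure lebesgue {y. \<bar>(y - c) \<bullet> e\<bar> \<le> A \<and> \<bar>(y - d) \<bullet> f\<bar> \<le> B} = 4 * A * B / \<bar>e \<bullet> perp f\<bar>"
  unfolding parallelogram_shift
  using measure_parallelogram[OF assms(1), of "2 * A" "2 * B" "c \<bullet> e - A" "d \<bullet> f - B"] assms(2,3)
  by simp_all

lemma perp_perp [simp]: "perp (perp e) = - e"
  by (simp add: vec2_eq_iff)

lemma orect_lmeasurable [simp]:
  assumes "norm e = 1" "0 \<le> A" "0 \<le> B"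
  shows "orect e c A B \<in> lmeasurable"
  unfolding orect_def using assms
  by (intro measure_strip_inter) (simp_all add: dot_square_norm)

lemma measure_orect:
  assumes "norm e = 1" "0 \<le> A" "0 \<le> B"
  shows "measure lebesgue (orect e c A B) = 4 * A * B"
  unfolding orect_def using assms
  by (subst measure_strip_inter) (simp_all add: dot_square_norm)

lemma emeasure_orect:
  assumes "norm e = 1" "0 \<le> A" "0 \<le> B"
  shows "emeasure lebesgue (orect e c A B) = ennreal (4 * A * B)"
  using measure_orect[OF assms] orect_lmeasurable[OF assms]
  by (metis emeasure_eq_measure2 fmeasurableD2 fmeasurable_def)

lemma orthonormal_expand:
  fixes e x :: "real^2"
  assumes "norm e = 1"
  shows "x = (x \<bullet> e) *\<^sub>R e + (x \<bullet> perp e) *\<^sub>R perp e"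
proof -
  have e: "e $ 1 * e $ 1 + e $ 2 * e $ 2 = 1"
    using assms by (simp add: norm_eq_sqrt_inner inner_vec2)
  have "((x \<bullet> e) *\<^sub>R e + (x \<bullet> perp e) *\<^sub>R perp e) $ i = (e $ 1 * e $ 1 + e $ 2 * e $ 2) * x $ i"
    if "i = 1 \<or> i = 2" for i
    using that by (auto simp: inner_vec2 algebra_simps)
  from this[of 1] this[of 2] show ?thesis unfolding vec2_eq_iff e by simp
qed

lemma abs_le_half_iff:
  fixes k z :: real
  assumes "k \<noteq> 0"
  shows "\<bar>z\<bar> \<le> \<bar>k\<bar> / 2 \<longleftrightarrow> z / k + 1 / 2 \<in> {0..1}"
  using assms by (cases "k > 0") (auto simp: field_simps abs_if)

lemma rectangle_eq_orect:
  fixes e a :: "real^2"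
  assumes e: "norm e = 1" and k: "k \<noteq> 0" and m: "m \<noteq> 0"
  shows "rectangle a (k *\<^sub>R e) (m *\<^sub>R perp e) =
    orect e (a + (k / 2) *\<^sub>R e + (m / 2) *\<^sub>R perp e) (\<bar>k\<bar> / 2) (\<bar>m\<bar> / 2)" (is "_ = orect e ?c _ _")
proof -
  have ee: "e \<bullet> e = 1" using e by (simp add: dot_square_norm)
  have co: "(a + s *\<^sub>R k *\<^sub>R e + t *\<^sub>R m *\<^sub>R perp e - ?c) \<bullet> e / k + 1 / 2 = s"
    "(a + s *\<^sub>R k *\<^sub>R e + t *\<^sub>R m *\<^sub>R perp e - ?c) \<bullet> perp e / m + 1 / 2 = t" for s t
    using k m by (simp_all add: inner_diff_left inner_add_left ee field_simps)
  show ?thesis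
  proof
    show "rectangle a (k *\<^sub>R e) (m *\<^sub>R perp e) \<subseteq> orect e ?c (\<bar>k\<bar> / 2) (\<bar>m\<bar> / 2)"
      unfolding rectangle_def orect_def abs_le_half_iff[OF k] abs_le_half_iff[OF m]
      using co by auto
    show "orect e ?c (\<bar>k\<bar> / 2) (\<bar>m\<bar> / 2) \<subseteq> rectangle a (k *\<^sub>R e) (m *\<^sub>R perp e)"
    proof
      fix y assume y: "y \<in> orect e ?c (\<bar>k\<bar> / 2) (\<bar>m\<bar> / 2)"
      define s where "s = (y - ?c) \<bullet> e / k + 1 / 2"
      define t where "t = (y - ?c) \<bullet> perp e / m + 1 / 2"
      have st: "s \<in> {0..1}" "t \<in> {0..1}"
        using y unfolding orect_def abs_le_half_iff[OF k] abs_le_half_iff[OF m] s_def t_def by auto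
      have "y = ?c + (((y - ?c) \<bullet> e) *\<^sub>R e + ((y - ?c) \<bullet> perp e) *\<^sub>R perp e)"
        using orthonormal_expand[OF e, of "y - ?c"] by simp
      also have "(y - ?c) \<bullet> e = (s - 1 / 2) * k" using k by (simp add: s_def)
      also have "(y - ?c) \<bullet> perp e = (t - 1 / 2) * m" using m by (simp add: t_def)
      finally have "y = a + s *\<^sub>R k *\<^sub>R e + t *\<^sub>R m *\<^sub>R perp e" by (simp add: algebra_simps)
      then show "y \<in> rectangle a (k *\<^sub>R e) (m *\<^sub>R perp e)" unfolding rectangle_def using st by blast
    qed
  qed
qed

lemma orect_eq_rectangle:
  assumes "norm e = 1" "0 < A" "0 < B"
  shows "orect e c A B = rectangle (c - A *\<^sub>R e - B *\<^sub>R perp e) ((2 * A) *\<^sub>R e) ((2 * B) *\<^sub>R perp e)"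
  using assms by (subst rectangle_eq_orect) simp_all

lemma directional_rectangles_eq:
  assumes "\<And>\<sigma>. \<sigma> \<in> \<Sigma> \<Longrightarrow> norm \<sigma> = 1"
  shows "directional_rectangles \<Sigma> = {orect \<sigma> c A B | \<sigma> c A B. \<sigma> \<in> \<Sigma> \<and> 0 < B \<and> B \<le> A}"
proof (intro equalityI subsetI)
  fix R assume "R \<in> directional_rectangles \<Sigma>"
  then obtain a u v \<sigma> k where R: "R = rectangle a u v" "u \<noteq> 0" "v \<noteq> 0" "u \<bullet> v = 0" "norm v \<le> norm u"
    "\<sigma> \<in> \<Sigma>" "u = k *\<^sub>R \<sigma>" unfolding directional_rectangles_def by blast
  have n: "norm \<sigma> = 1" using assms R by simp
  have k: "k \<noteq> 0" using R by auto
  then have "v \<bullet> \<sigma> = 0" using R by (simp add: inner_commute)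
  then obtain m where v: "v = m *\<^sub>R perp \<sigma>"
    using orthonormal_expand[OF n, of v] by (metis add.left_neutral scaleR_zero_left)
  have m: "m \<noteq> 0" using v R(3) by auto
  have "R = orect \<sigma> (a + (k / 2) *\<^sub>R \<sigma> + (m / 2) *\<^sub>R perp \<sigma>) (\<bar>k\<bar> / 2) (\<bar>m\<bar> / 2)"
    unfolding R(1) R(7) v by (rule rectangle_eq_orect[OF n k m])
  moreover have "\<bar>m\<bar> / 2 \<le> \<bar>k\<bar> / 2" using R(5) unfolding R(7) v by (simp add: n)
  moreover have "0 < \<bar>m\<bar> / 2" using m by simp
  ultimately show "R \<in> {orect \<sigma> c A B | \<sigma> c A B. \<sigma> \<in> \<Sigma> \<and> 0 < B \<and> B \<le> A}"
    unfolding mem_Collect_eq using R(6)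
    by - (rule exI[of _ \<sigma>], rule exI, rule exI, rule exI, rule conjI, assumption, simp)
next
  fix R assume "R \<in> {orect \<sigma> c A B | \<sigma> c A B. \<sigma> \<in> \<Sigma> \<and> 0 < B \<and> B \<le> A}"
  then obtain \<sigma> c A B where R: "R = orect \<sigma> c A B" "\<sigma> \<in> \<Sigma>" "0 < B" "B \<le> A" by blast
  have n: "norm \<sigma> = 1" using assms R by simp
  then have "\<sigma> \<noteq> 0" "perp \<sigma> \<noteq> 0" using norm_perp[of \<sigma>] by (metis norm_zero zero_neq_one)+
  moreover have "R = rectangle (c - A *\<^sub>R \<sigma> - B *\<^sub>R perp \<sigma>) ((2 * A) *\<^sub>R \<sigma>) ((2 * B) *\<^sub>R perp \<sigma>)"
    using orect_eq_rectangle[OF n] R by simp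
  ultimately show "R \<in> directional_rectangles \<Sigma>"
    unfolding directional_rectangles_def mem_Collect_eq using R n
    by - (rule exI, rule exI, rule exI, rule conjI, assumption, auto)
qed

lemma squares_eq: "squares = {orect e c A A | e c A. norm e = 1 \<and> 0 < A}"
proof (intro equalityI subsetI)
  fix R assume "R \<in> squares"
  then obtain a u v where R: "R = rectangle a u v" "u \<noteq> 0" "v \<noteq> 0" "u \<bullet> v = 0" "norm u = norm v"
    unfolding squares_def by blast
  define \<sigma> where "\<sigma> = u /\<^sub>R norm u"
  define k where "k = norm u"
  have n: "norm \<sigma> = 1" using R by (simp add: \<sigma>_def)
  have k: "k > 0" and u: "u = k *\<^sub>R \<sigma>" using R by (auto simp: k_def \<sigma>_def)
  then have "v \<bullet> \<sigma> = 0" using R by (simp add: inner_commute)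
  then obtain m where v: "v = m *\<^sub>R perp \<sigma>"
    using orthonormal_expand[OF n, of v] by (metis add.left_neutral scaleR_zero_left)
  have "\<bar>m\<bar> = norm v" by (simp add: v n)
  then have m: "\<bar>m\<bar> = k" using R(5) k_def by simp
  then have m0: "m \<noteq> 0" using k by auto
  have "R = orect \<sigma> (a + (k / 2) *\<^sub>R \<sigma> + (m / 2) *\<^sub>R perp \<sigma>) (\<bar>k\<bar> / 2) (\<bar>m\<bar> / 2)"
    unfolding R(1) unfolding v by (subst u, rule rectangle_eq_orect[OF n _ m0]) (use k in simp)
  moreover have "\<bar>m\<bar> / 2 = \<bar>k\<bar> / 2" "0 < \<bar>k\<bar> / 2" using m k by simp_all
  ultimately show "R \<in> {orect e c A A | e c A. norm e = 1 \<and> 0 < A}"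
    unfolding mem_Collect_eq using n
    by - (rule exI[of _ \<sigma>], rule exI, rule exI, rule conjI, simp, simp)
next
  fix R assume "R \<in> {orect e c A A | e c A. norm e = 1 \<and> 0 < A}"
  then obtain \<sigma> c A where R: "R = orect \<sigma> c A A" "norm \<sigma> = 1" "0 < A" by blast
  then have "\<sigma> \<noteq> 0" "perp \<sigma> \<noteq> 0" using norm_perp[of \<sigma>] by (metis norm_zero zero_neq_one)+
  moreover have "R = rectangle (c - A *\<^sub>R \<sigma> - A *\<^sub>R perp \<sigma>) ((2 * A) *\<^sub>R \<sigma>) ((2 * A) *\<^sub>R perp \<sigma>)"
    using orect_eq_rectangle R by simp
  ultimately show "R \<in> squares"
    unfolding squares_def mem_Collect_eq using R
    by - (rule exI, rule exI, rule exI, rule conjI, assumption, auto)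
qed

section \<open>Separation of the uniform directions\<close>

lemma norm_uniform_directions: "\<sigma> \<in> uniform_directions N \<Longrightarrow> norm \<sigma> = 1"
  by (auto simp: uniform_directions_def norm_eq_sqrt_inner inner_vec2 simp flip: power2_eq_square)

text \<open>A crude form of Jordan's inequality. Up to \<open>pi / 3\<close> the mean value theorem
  applies with cosine at least 1/2; beyond it the sine is at least 1/2, while \<open>x / 4\<close>
  stays below 1/2.\<close>

lemma sin_ge_quarter:
  fixes x :: real
  assumes "0 \<le> x" "x \<le> pi / 2"
  shows "x / 4 \<le> sin x"
proof (cases "x \<le> pi / 3")
  case True
  show ?thesis
  proof (cases "0 < x")
    case x: True
    then obtain z where z: "0 < z" "z < x" "sin x = x * cos z"
      using MVT2[of 0 x sin cos] by (auto intro!: derivative_eq_intros)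
    have "cos (pi / 3) \<le> cos z" using z True by (intro cos_monotone_0_pi_le) auto
    then have "1 / 4 \<le> cos z" by (simp add: cos_60)
    then have "x * (1 / 4) \<le> x * cos z" using x by (intro mult_left_mono) auto
    then show ?thesis using z by simp
  qed (use assms in auto)
next
  case False
  have "sin (pi / 6) \<le> sin x" using False assms by (intro sin_monotone_2pi_le) auto
  then show ?thesis using assms pi_half_less_two by (simp add: sin_30)
qed

text \<open>Reducing \<open>k\<close> modulo \<open>N\<close> changes at most the sign of the sine,
  and reflecting the angle at \<open>pi / 2\<close> brings the remainder below \<open>N / 2\<close>,
  where the linear lower bound for the sine applies.\<close>

lemma sin_rational_multiple_gap:
  fixes k :: int and N :: nat
  assumes N: "N > 0"
  shows "sin (pi * k / N) = 0 \<or> 1 / (2 * N) \<le> \<bar>sin (pi * k / N)\<bar>"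
proof -
  define r where "r = k mod int N"
  have r: "0 \<le> r" "r < int N" using N by (auto simp: r_def)
  have k: "real_of_int k = real_of_int r + N * real_of_int (k div int N)"
    unfolding r_def by (metis add.commute of_int_add of_int_mult of_int_of_nat_eq mult_div_mod_eq)
  have "pi * k / N = pi * r / N + pi * (k div int N)"
    using N by (subst k) (simp add: field_simps)
  then have *: "\<bar>sin (pi * k / N)\<bar> = \<bar>sin (pi * r / N)\<bar>"
    by (simp add: sin_add sin_npi_int cos_npi_int abs_mult)
  have **: "1 / (2 * N) \<le> sin (pi * q / N)" if q: "1 \<le> q" "2 * q \<le> N" for q :: real
  proof -
    have "1 / (2 * N) \<le> pi * q / N / 4"
      using N mult_mono[of 2 pi 1 q] q pi_ge_two by (simp add: field_simps)
    also have "\<dots> \<le> sin (pi * q / N)" using N q by (intro sin_ge_quarter) (auto simp: field_simps)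
    finally show ?thesis .
  qed
  consider "r = 0" | "r \<ge> 1" "2 * r \<le> N" | "2 * r > N" using r by linarith
  then show ?thesis
  proof cases
    case 1
    then show ?thesis using * by simp
  next
    case 2
    then have "1 \<le> real_of_int r" "2 * real_of_int r \<le> N" by linarith+
    from **[OF this] have "1 / (2 * N) \<le> \<bar>sin (pi * r / N)\<bar>" by linarith
    then show ?thesis using * by simp
  next
    case 3
    then have "real N < 2 * real_of_int r" by linarith
    then have "1 \<le> N - real_of_int r" "2 * (N - real_of_int r) \<le> N" using r by (linarith, simp)
    from **[OF this] have "1 / (2 * N) \<le> sin (pi - pi * r / N)"
      using N by (simp add: right_diff_distrib diff_divide_distrib)
    then have "1 / (2 * N) \<le> \<bar>sin (pi * r / N)\<bar>" by simp
    then show ?thesis using * by simp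
  qed
qed

text \<open>The inner product is the sine of the angle between the two directions; it vanishes for
  opposite directions as well as for equal ones. The gap is what makes the number of dyadic scales
  logarithmic in \<open>N\<close>.\<close>

lemma uniform_directions_gap:
  assumes "\<sigma> \<in> uniform_directions N" "\<tau> \<in> uniform_directions N"
  shows "\<sigma> \<bullet> perp \<tau> = 0 \<or> 1 / (2 * N) \<le> \<bar>\<sigma> \<bullet> perp \<tau>\<bar>"
proof -
  obtain i j where ij: "i < N" "\<sigma> = vector [cos (2 * pi * real i / real N), sin (2 * pi * real i / real N)]"
    "\<tau> = vector [cos (2 * pi * real j / real N), sin (2 * pi * real j / real N)]"
    using assms by (auto simp: uniform_directions_def)
  have "\<sigma> \<bullet> perp \<tau> = sin (2 * pi * real i / real N - 2 * pi * real j / real N)"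
    by (simp add: ij inner_vec2 sin_diff)
  also have "2 * pi * real i / real N - 2 * pi * real j / real N = pi * of_int (2 * (int i - int j)) / N"
    by (simp add: diff_divide_distrib[symmetric] algebra_simps)
  finally show ?thesis using sin_rational_multiple_gap[of N "2 * (int i - int j)"] ij(1) by auto
qed

section \<open>Overlap of two rectangles compared with mass near a point\<close>

text \<open>Clamp \<open>\<xi>\<close> to the interval from \<open>- a\<close> to \<open>a\<close>
  and step inwards by \<open>\<rho>\<close>. Along the axis of a long rectangle this finds a piece
  of length \<open>\<rho>\<close> near a point that may overshoot the end by
  \<open>K\<close>.\<close>

lemma exists_clamped_interval:
  fixes \<xi> a \<rho> K :: real
  assumes "\<bar>\<xi>\<bar> \<le> a + K" "0 \<le> \<rho>" "\<rho> \<le> a" "0 \<le> K"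
  obtains b where "\<And>t. b \<le> t \<Longrightarrow> t \<le> b + \<rho> \<Longrightarrow> \<bar>t\<bar> \<le> a \<and> \<bar>t - \<xi>\<bar> \<le> K + \<rho>"
proof (cases "0 \<le> \<xi>")
  case True
  show ?thesis by (rule that[of "min \<xi> a - \<rho>"]) (use True assms in \<open>auto simp: min_def split: if_splits\<close>)
next
  case False
  show ?thesis by (rule that[of "max \<xi> (- a)"]) (use False assms in \<open>auto simp: max_def split: if_splits\<close>)
qed

text \<open>The dilate of the longer rectangle has a large part near \<open>x\<close> because the shorter one, seen from
  it, has transversal extent at most \<open>4 \<rho>\<close>. The intersection is small because it lies in two
  parallelograms, cut out by the long strip of the longer rectangle and one of the two strips of the
  shorter one; one of their areas is always small enough.\<close>
lemma measure_orect_inter_le: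
  fixes e e' c c' x :: "real^2"
  assumes e: "norm e = 1" and e': "norm e' = 1"
    and B: "0 < B" "B \<le> A" and B': "0 < B'" "B' \<le> A'" and A: "A \<le> A'"
    and x: "x \<in> orect e c A B"
    and r: "max B (\<bar>e \<bullet> perp e'\<bar> * A) \<le> \<rho>" "\<rho> \<le> 2 * max B (\<bar>e \<bullet> perp e'\<bar> * A)"
  shows "measure lebesgue (orect e' c' A' B' \<inter> orect e c A B) * \<rho>\<^sup>2
    \<le> 4 * measure lebesgue (orect e c A B) * measure lebesgue (orect e' c' (3 * A') (3 * B') \<inter> ball x (9 * \<rho>))"
proof (cases "orect e' c' A' B' \<inter> orect e c A B = {}")
  case True
  then show ?thesis by simp
next
  case False
  define s where "s = \<bar>e \<bullet> perp e'\<bar>"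
  define co where "co = \<bar>e \<bullet> e'\<bar>"
  define r where "r = max B (s * A)"
  have s1: "s \<le> 1" "co \<le> 1"
    using Cauchy_Schwarz_ineq2[of e "perp e'"] Cauchy_Schwarz_ineq2[of e e'] by (auto simp: s_def co_def e e')
  have sc: "s\<^sup>2 + co\<^sup>2 = 1"
    using orthonormal_norm_expand[OF e', of e] by (simp add: s_def co_def e)
  have r0: "0 < r" "r \<le> \<rho>" "\<rho> \<le> 2 * r" "r \<le> A"
    using r B s1 mult_right_mono[of s 1 A] by (auto simp: r_def s_def)
  obtain z where z: "z \<in> orect e' c' A' B'" "z \<in> orect e c A B" using False by auto
  have "(x - z) \<bullet> e = (x - c) \<bullet> e - (z - c) \<bullet> e" "(x - z) \<bullet> perp e = (x - c) \<bullet> perp e - (z - c) \<bullet> perp e"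
    by (simp_all add: inner_diff_left)
  moreover have "\<bar>(x - c) \<bullet> e\<bar> \<le> A" "\<bar>(x - c) \<bullet> perp e\<bar> \<le> B" "\<bar>(z - c) \<bullet> e\<bar> \<le> A" "\<bar>(z - c) \<bullet> perp e\<bar> \<le> B"
    using x z(2) by (simp_all add: orect_def)
  ultimately have xz: "\<bar>(x - z) \<bullet> e\<bar> \<le> 2 * A" "\<bar>(x - z) \<bullet> perp e\<bar> \<le> 2 * B"
    by linarith+
  have "\<bar>(x - z) \<bullet> perp e'\<bar> \<le> \<bar>(x - z) \<bullet> e\<bar> * s + \<bar>(x - z) \<bullet> perp e\<bar> * co"
    using orthonormal_inner_expand[OF e, of "x - z" "perp e'"]
    by (simp add: s_def co_def inner_commute abs_mult[symmetric] abs_triangle_ineq)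
  also have "\<dots> \<le> (2 * A) * s + (2 * B) * 1"
    using xz s1 B by (intro add_mono mult_mono) (auto simp: s_def co_def)
  also have "\<dots> = 2 * (s * A) + 2 * B" by simp
  also have "\<dots> \<le> 2 * \<rho> + 2 * \<rho>" using r0(2) by (intro add_mono) (simp_all add: r_def)
  also have "\<dots> = 4 * \<rho>" by simp
  finally have xz1: "\<bar>(x - z) \<bullet> perp e'\<bar> \<le> 4 * \<rho>" .
  have "e' \<bullet> perp e = - (e \<bullet> perp e')" by (simp add: inner_vec2 algebra_simps)
  then have hs: "s = \<bar>e' \<bullet> perp e\<bar>" by (simp add: s_def)
  have "\<bar>(x - z) \<bullet> e'\<bar> \<le> \<bar>(x - z) \<bullet> e\<bar> * co + \<bar>(x - z) \<bullet> perp e\<bar> * s"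
    using orthonormal_inner_expand[OF e, of "x - z" "e'"]
      abs_triangle_ineq[of "((x - z) \<bullet> e) * (e' \<bullet> e)" "((x - z) \<bullet> perp e) * (e' \<bullet> perp e)"]
    by (simp add: hs co_def abs_mult inner_commute[of e])
  also have "\<dots> \<le> (2 * A) * 1 + (2 * B) * 1"
    using xz s1 B by (intro add_mono mult_mono) (auto simp: s_def co_def)
  also have "\<dots> \<le> 2 * A' + 2 * \<rho>" using r0 A by (auto simp: r_def)
  finally have xz2: "\<bar>(x - z) \<bullet> e'\<bar> \<le> 2 * A' + 2 * \<rho>" .
  \<comment> \<open>The box \<open>P\<close> below has sides \<open>\<rho>\<close> and
    \<open>m\<close> in the axes of the longer rectangle. Its width may exceed neither
    \<open>\<rho>\<close>, to stay in the ball, nor \<open>B'\<close>, to stay in the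
    dilate.\<close>
  define m where "m = min \<rho> B'"
  have m: "0 < m" "m \<le> \<rho>" "m \<le> B'" using r0 B' by (auto simp: m_def)
  have zz: "\<bar>(z - c') \<bullet> e'\<bar> \<le> A'" "\<bar>(z - c') \<bullet> perp e'\<bar> \<le> B'"
    using z(1) by (auto simp: orect_def)
  have "(x - c') \<bullet> e' = (x - z) \<bullet> e' + (z - c') \<bullet> e'" by (simp add: inner_diff_left)
  \<comment> \<open>Origin of the dilation factor 3: \<open>z\<close> has coordinate at most
    \<open>A'\<close>, and \<open>x\<close> may be farther out by the whole length of the shorter
    rectangle, at most \<open>2 * A'\<close>, up to a multiple of \<open>\<rho>\<close>.\<close>
  then have "\<bar>(x - c') \<bullet> e'\<bar> \<le> 3 * A' + 2 * \<rho>" using zz(1) xz2 by linarith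
  then obtain b where b: "\<And>t. b \<le> t \<Longrightarrow> t \<le> b + \<rho> \<Longrightarrow> \<bar>t\<bar> \<le> 3 * A' \<and> \<bar>t - (x - c') \<bullet> e'\<bar> \<le> 2 * \<rho> + \<rho>"
    using exists_clamped_interval[of "(x - c') \<bullet> e'" "3 * A'" "2 * \<rho>" \<rho>] r0 A B by auto
  define d where "d = (z - c') \<bullet> perp e'"
  define P where "P = {y. c' \<bullet> e' + b \<le> y \<bullet> e' \<and> y \<bullet> e' \<le> (c' \<bullet> e' + b) + \<rho> \<and>
      c' \<bullet> perp e' + d \<le> y \<bullet> perp e' \<and> y \<bullet> perp e' \<le> (c' \<bullet> perp e' + d) + m}"
  have P: "P \<in> lmeasurable" "measure lebesgue P = \<rho> * m"
    using measure_parallelogram[of e' "perp e'" \<rho> m "c' \<bullet> e' + b" "c' \<bullet> perp e' + d"] r0 m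
    by (simp_all add: P_def e' dot_square_norm)
  have "P \<subseteq> orect e' c' (3 * A') (3 * B') \<inter> ball x (9 * \<rho>)"
  proof
    fix y assume "y \<in> P"
    then have 1: "b \<le> (y - c') \<bullet> e'" "(y - c') \<bullet> e' \<le> b + \<rho>"
      and 2: "d \<le> (y - c') \<bullet> perp e'" "(y - c') \<bullet> perp e' \<le> d + m"
      by (auto simp: P_def inner_diff_left)
    have 3: "\<bar>(y - c') \<bullet> perp e'\<bar> \<le> 3 * B'" using 2 m zz(2) B' d_def by linarith
    have "(y - x) \<bullet> e' = (y - c') \<bullet> e' - (x - c') \<bullet> e'" by (simp add: inner_diff_left)
    then have 4: "\<bar>(y - x) \<bullet> e'\<bar> \<le> 3 * \<rho>" using b[OF 1] by linarith
    have "(y - x) \<bullet> perp e' = ((y - c') \<bullet> perp e' - d) - (x - z) \<bullet> perp e'"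
      by (simp add: inner_diff_left d_def)
    then have 5: "\<bar>(y - x) \<bullet> perp e'\<bar> \<le> 5 * \<rho>" using 2 m xz1 by linarith
    have "(norm (y - x))\<^sup>2 = ((y - x) \<bullet> e')\<^sup>2 + ((y - x) \<bullet> perp e')\<^sup>2"
      by (rule orthonormal_norm_expand[OF e'])
    also have "\<dots> \<le> (3 * \<rho>)\<^sup>2 + (5 * \<rho>)\<^sup>2"
    proof (rule add_mono)
      show "((y - x) \<bullet> e')\<^sup>2 \<le> (3 * \<rho>)\<^sup>2" "((y - x) \<bullet> perp e')\<^sup>2 \<le> (5 * \<rho>)\<^sup>2"
        using 4 5 r0 power2_le_iff_abs_le[of "3 * \<rho>"] power2_le_iff_abs_le[of "5 * \<rho>"] by simp_all
    qed
    \<comment> \<open>The radius has room to spare: 9 + 25 is well below 81.\<close>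
    also have "\<dots> < (9 * \<rho>)\<^sup>2" using r0 by (simp add: power_mult_distrib)
    finally have "norm (y - x) < 9 * \<rho>" by (rule power2_less_imp_less) (use r0 in simp)
    then show "y \<in> orect e' c' (3 * A') (3 * B') \<inter> ball x (9 * \<rho>)"
      using b[OF 1] 3 by (simp add: orect_def dist_norm norm_minus_commute)
  qed
  then have lower: "\<rho> * m \<le> measure lebesgue (orect e' c' (3 * A') (3 * B') \<inter> ball x (9 * \<rho>))"
    unfolding P(2)[symmetric] using P(1) e' B'
    by (intro measure_mono_fmeasurable fmeasurable_Int_fmeasurable) auto
  have mR: "measure lebesgue (orect e c A B) = 4 * A * B" using e B by (intro measure_orect) auto
  have I: "orect e' c' A' B' \<inter> orect e c A B \<in> lmeasurable"
    using e e' B B' by (intro fmeasurable.Int orect_lmeasurable) auto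
  \<comment> \<open>Combined with \<open>lower\<close>, this bound is all that remains to be
    shown.\<close>
  have "measure lebesgue (orect e' c' A' B' \<inter> orect e c A B) * \<rho> \<le> 16 * A * B * m"
  proof (cases "B' \<le> \<rho>")
    case False
    have "measure lebesgue (orect e' c' A' B' \<inter> orect e c A B) \<le> 4 * A * B"
      unfolding mR[symmetric] using e B I by (intro measure_mono_fmeasurable) auto
    moreover have "m = \<rho>" using False by (simp add: m_def)
    moreover have "4 * A * B \<ge> 0" using B by simp
    ultimately have "measure lebesgue (orect e' c' A' B' \<inter> orect e c A B) \<le> 16 * A * B" by linarith
    then show ?thesis using r0 \<open>m = \<rho>\<close> by (auto intro!: mult_right_mono)
  next
    case True
    then have mB: "m = B'" by (simp add: m_def)
    have c_bound: "measure lebesgue (orect e' c' A' B' \<inter> orect e c A B) \<le> 4 * A * B' / co" if "co \<noteq> 0"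
    proof -
      have D: "\<bar>e \<bullet> perp (perp e')\<bar> = co" by (simp add: co_def)
      then have "e \<bullet> perp (perp e') \<noteq> 0" using that by linarith
      note * = measure_strip_inter[OF this, of A B' c c']
      have "measure lebesgue (orect e' c' A' B' \<inter> orect e c A B)
          \<le> measure lebesgue {y. \<bar>(y - c) \<bullet> e\<bar> \<le> A \<and> \<bar>(y - c') \<bullet> perp e'\<bar> \<le> B'}"
        using I * B B' by (intro measure_mono_fmeasurable) (auto simp: orect_def)
      then show ?thesis using * B B' D by simp
    qed
    have s_bound: "measure lebesgue (orect e' c' A' B' \<inter> orect e c A B) \<le> 4 * B * B' / s" if "s \<noteq> 0"
    proof -
      have D: "\<bar>perp e \<bullet> perp (perp e')\<bar> = s" unfolding perp_inner_perp by (simp add: s_def)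
      then have "perp e \<bullet> perp (perp e') \<noteq> 0" using that by linarith
      note * = measure_strip_inter[OF this, of B B' c c']
      have "measure lebesgue (orect e' c' A' B' \<inter> orect e c A B)
          \<le> measure lebesgue {y. \<bar>(y - c) \<bullet> perp e\<bar> \<le> B \<and> \<bar>(y - c') \<bullet> perp e'\<bar> \<le> B'}"
        using I * B B' by (intro measure_mono_fmeasurable) (auto simp: orect_def)
      then show ?thesis using * B B' D by simp
    qed
    have div_bound: "a / t \<le> 2 * a" if "1 / 2 \<le> t" "0 \<le> a" for a t :: real
      using mult_left_mono[of 1 "2 * t" a] that by (simp add: field_simps)
    show ?thesis
    proof (cases "s * A \<ge> B")
      case True
      then have rs: "r = s * A" by (simp add: r_def)
      then have s0: "s > 0" using r0 B by (simp add: zero_less_mult_iff)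
      have "measure lebesgue (orect e' c' A' B' \<inter> orect e c A B) * \<rho> \<le> 4 * B * B' / s * (2 * (s * A))"
        using s_bound s0 r0 rs B B' by (intro mult_mono) auto
      also have "\<dots> = 8 * A * B * B'" using s0 by simp
      also have "\<dots> \<le> 16 * A * B * B'" using B B' by (intro mult_right_mono) auto
      finally show ?thesis by (simp add: mB)
    next
      case False
      then have rB: "r = B" by (simp add: r_def)
      \<comment> \<open>The parallelogram with area divided by \<open>co\<close> is useless for
        nearly perpendicular rectangles. In that case \<open>s\<close> is at least 1/2 and the other
        parallelogram serves.\<close>
      have "measure lebesgue (orect e' c' A' B' \<inter> orect e c A B) \<le> 8 * A * B'"
      proof (cases "1 / 2 \<le> co")
        case True
        then show ?thesis using c_bound div_bound[OF True, of "4 * A * B'"] B B' by auto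
      next
        case False
        then have "co\<^sup>2 \<le> (1 / 2)\<^sup>2" by (intro power_mono) (auto simp: co_def)
        then have "(1 / 2)\<^sup>2 \<le> s\<^sup>2" using sc by (simp add: power2_eq_square)
        then have s2: "1 / 2 \<le> s" by (rule power2_le_imp_le) (simp add: s_def)
        then have "measure lebesgue (orect e' c' A' B' \<inter> orect e c A B) \<le> 8 * B * B'"
          using s_bound div_bound[OF s2, of "4 * B * B'"] B B' by auto
        also have "\<dots> \<le> 8 * A * B'" using B B' by (intro mult_right_mono) auto
        finally show ?thesis .
      qed
      then have "measure lebesgue (orect e' c' A' B' \<inter> orect e c A B) * \<rho> \<le> 8 * A * B' * (2 * B)"
        using r0 rB B B' by (intro mult_mono) auto
      then show ?thesis by (simp add: mB mult_ac)
    qed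
  qed
  then have "measure lebesgue (orect e' c' A' B' \<inter> orect e c A B) * \<rho> * \<rho> \<le> 16 * A * B * m * \<rho>"
    using r0 by (intro mult_right_mono) auto
  also have "\<dots> = 4 * measure lebesgue (orect e c A B) * (\<rho> * m)" by (simp add: mR)
  also have "\<dots> \<le> 4 * measure lebesgue (orect e c A B) * measure lebesgue (orect e' c' (3 * A') (3 * B') \<inter> ball x (9 * \<rho>))"
    using lower by (intro mult_left_mono) auto
  finally show ?thesis by (simp add: power2_eq_square mult.assoc)
qed

section \<open>Pigeonhole over dyadic scales\<close>

lemma exists_dyadic_scale:
  fixes s :: real
  assumes "0 < \<delta>" "\<delta> \<le> s" "s \<le> 1"
  obtains m :: nat where "2 ^ m \<le> 1 / \<delta>" "s \<le> 1 / 2 ^ m" "1 / 2 ^ m \<le> 2 * s"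
proof -
  have s: "0 < s" using assms by simp
  obtain n where n: "1 / s < 2 ^ n" using real_arch_pow[of 2 "1 / s"] by auto
  define k where "k = (LEAST n. 1 / s < (2::real) ^ n)"
  have k: "1 / s < 2 ^ k" unfolding k_def using n by (rule LeastI)
  have "k \<noteq> 0" using k assms s by (intro notI) (simp add: field_simps)
  then obtain m where m: "k = Suc m" using not0_implies_Suc by blast
  have "\<not> 1 / s < 2 ^ m" using not_less_Least[of m "\<lambda>n. 1 / s < (2::real) ^ n"] m by (simp add: k_def)
  then have "2 ^ m \<le> 1 / s" by simp
  moreover have "1 / s \<le> 1 / \<delta>" using assms by (simp add: frac_le)
  ultimately have "2 ^ m \<le> 1 / \<delta>" by linarith
  moreover have "s \<le> 1 / 2 ^ m" "1 / 2 ^ m \<le> 2 * s"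
    using \<open>2 ^ m \<le> 1 / s\<close> s k m by (simp_all add: field_simps)
  ultimately show ?thesis by (rule that)
qed

text \<open>The exponents \<open>m\<close> serve sines between \<open>1 / (2 * N)\<close> and 1,
  through the scales \<open>a / 2 ^ m\<close>. The successor accounts for one more scale, the width
  of the rectangle.\<close>

definition scale_count :: "nat \<Rightarrow> nat" where
  "scale_count N = Suc (card {m::nat. 2 ^ m \<le> 2 * real N})"

lemma finite_scales: "finite {m::nat. 2 ^ m \<le> 2 * real N}"
proof (rule finite_subset)
  show "{m::nat. 2 ^ m \<le> 2 * real N} \<subseteq> {..2 * N}"
  proof
    fix m :: nat assume "m \<in> {m. 2 ^ m \<le> 2 * real N}"
    then have "real (2 ^ m) \<le> real (2 * N)" by simp
    then have "2 ^ m \<le> 2 * N" unfolding of_nat_le_iff .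
    moreover have "m < 2 ^ m" by (rule less_exp)
    ultimately have "m \<le> 2 * N" by linarith
    then show "m \<in> {..2 * N}" by simp
  qed
qed simp

text \<open>If every mass were below \<open>\<rho>\<^sup>2 / 4\<close>, each scale would contribute
  less than the area of the rectangle to the total overlap, since the 4 in the overlap estimate
  cancels; with at most \<open>scale_count N\<close> scales this contradicts
  \<open>big\<close>.\<close>

lemma exists_scale_large_mass:
  fixes S :: "'i set" and \<sigma> c :: "'i \<Rightarrow> real^2" and A B :: "'i \<Rightarrow> real"
  assumes N: "N > 0" and S: "finite S"
    and R: "\<And>j. j \<in> S \<Longrightarrow> \<sigma> j \<in> uniform_directions N \<and> 0 < B j \<and> B j \<le> A j \<and> a \<le> A j"
    and e: "e \<in> uniform_directions N" and b: "0 < b" "b \<le> a" and x: "x \<in> orect e d a b"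
    and big: "scale_count N * measure lebesgue (orect e d a b)
      \<le> (\<Sum>j\<in>S. measure lebesgue (orect (\<sigma> j) (c j) (A j) (B j) \<inter> orect e d a b))"
  shows "\<exists>\<rho>. 0 < \<rho> \<and> \<rho> \<le> a \<and>
    \<rho>\<^sup>2 / 4 \<le> (\<Sum>j\<in>S. measure lebesgue (orect (\<sigma> j) (c j) (3 * A j) (3 * B j) \<inter> ball x (9 * \<rho>)))"
proof (rule ccontr)
  assume "\<not> ?thesis"
  then have small: "(\<Sum>j\<in>S. measure lebesgue (orect (\<sigma> j) (c j) (3 * A j) (3 * B j) \<inter> ball x (9 * \<rho>))) < \<rho>\<^sup>2 / 4"
    if "0 < \<rho>" "\<rho> \<le> a" for \<rho> using that not_less by blast
  \<comment> \<open>The scale \<open>b\<close> serves all pairs whose transversal extent is governed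
    by the width, in particular parallel ones.\<close>
  define G where "G = insert b ((\<lambda>m. a / 2 ^ m) ` {m::nat. 2 ^ m \<le> 2 * real N})"
  have fG: "finite G" "G \<noteq> {}" using finite_scales by (auto simp: G_def)
  have cG: "card G \<le> scale_count N"
    unfolding G_def scale_count_def
    by (rule le_trans[OF card_insert_le_m1]) (use finite_scales card_image_le[OF finite_scales] in auto)
  have G: "0 < \<rho>" "\<rho> \<le> a" if "\<rho> \<in> G" for \<rho>
    using that b by (auto simp: G_def field_simps)
  have ne: "norm e = 1" using norm_uniform_directions e .
  define V where "V = measure lebesgue (orect e d a b)"
  have V: "V > 0" using b by (simp add: V_def measure_orect[OF ne])
  define Q where "Q j \<rho> = measure lebesgue (orect (\<sigma> j) (c j) (3 * A j) (3 * B j) \<inter> ball x (9 * \<rho>))" for j \<rho>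
  have Q0: "0 \<le> Q j \<rho>" for j \<rho> by (simp add: Q_def)
  \<comment> \<open>The suitable scale depends on \<open>j\<close>. Summing over all of
    \<open>G\<close> removes this dependence, so that the two sums can be exchanged.\<close>
  have one: "measure lebesgue (orect (\<sigma> j) (c j) (A j) (B j) \<inter> orect e d a b) \<le> (\<Sum>\<rho>\<in>G. 4 * V / \<rho>\<^sup>2 * Q j \<rho>)"
    if j: "j \<in> S" for j
  proof -
    define s where "s = \<bar>e \<bullet> perp (\<sigma> j)\<bar>"
    have nj: "norm (\<sigma> j) = 1" using norm_uniform_directions R j by blast
    have s1: "s \<le> 1" using Cauchy_Schwarz_ineq2[of e "perp (\<sigma> j)"] by (simp add: s_def ne nj)
    obtain \<rho> where \<rho>: "\<rho> \<in> G" "max b (s * a) \<le> \<rho>" "\<rho> \<le> 2 * max b (s * a)"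
    proof (cases "s * a \<le> b")
      case True
      then show ?thesis using that[of b] b by (simp add: G_def)
    next
      case False
      then have "s \<noteq> 0" using b by auto
      then have "1 / (2 * N) \<le> s" using uniform_directions_gap[OF e, of "\<sigma> j"] R[OF j] by (auto simp: s_def)
      then obtain m :: nat where m: "2 ^ m \<le> 1 / (1 / (2 * real N))" "s \<le> 1 / 2 ^ m" "1 / 2 ^ m \<le> 2 * s"
        using exists_dyadic_scale[of "1 / (2 * real N)" s] s1 N by auto
      have "m \<in> {m. 2 ^ m \<le> 2 * real N}" using m(1) by simp
      then have "a / 2 ^ m \<in> G" unfolding G_def by (intro insertI2 imageI)
      moreover have "s * a \<le> a / 2 ^ m" "a / 2 ^ m \<le> 2 * (s * a)"
        using mult_right_mono[OF m(2), of a] mult_right_mono[OF m(3), of a] b by auto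
      ultimately show ?thesis using that[of "a / 2 ^ m"] False by (simp add: max_def)
    qed
    have "measure lebesgue (orect (\<sigma> j) (c j) (A j) (B j) \<inter> orect e d a b) * \<rho>\<^sup>2 \<le> 4 * V * Q j \<rho>"
      unfolding V_def Q_def using \<rho> R[OF j] b x ne nj
      by (intro measure_orect_inter_le) (auto simp: s_def)
    then have "measure lebesgue (orect (\<sigma> j) (c j) (A j) (B j) \<inter> orect e d a b) \<le> 4 * V / \<rho>\<^sup>2 * Q j \<rho>"
      using G(1)[OF \<rho>(1)] by (simp add: field_simps)
    also have "\<dots> \<le> (\<Sum>\<rho>\<in>G. 4 * V / \<rho>\<^sup>2 * Q j \<rho>)"
      using \<rho>(1) V Q0 fG by (intro member_le_sum) auto
    finally show ?thesis .
  qed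
  have "(\<Sum>j\<in>S. measure lebesgue (orect (\<sigma> j) (c j) (A j) (B j) \<inter> orect e d a b))
      \<le> (\<Sum>j\<in>S. \<Sum>\<rho>\<in>G. 4 * V / \<rho>\<^sup>2 * Q j \<rho>)" by (intro sum_mono one)
  also have "\<dots> = (\<Sum>\<rho>\<in>G. 4 * V / \<rho>\<^sup>2 * (\<Sum>j\<in>S. Q j \<rho>))"
    by (subst sum.swap) (simp add: sum_distrib_left)
  also have "\<dots> < (\<Sum>\<rho>\<in>G. V)"
  proof (intro sum_strict_mono fG)
    fix \<rho> assume "\<rho> \<in> G"
    note \<rho> = G[OF this]
    have "4 * V / \<rho>\<^sup>2 * (\<Sum>j\<in>S. Q j \<rho>) < 4 * V / \<rho>\<^sup>2 * (\<rho>\<^sup>2 / 4)"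
      using small[OF \<rho>] V \<rho> unfolding Q_def by (intro mult_strict_left_mono) auto
    also have "\<dots> = V" using \<rho> by simp
    finally show "4 * V / \<rho>\<^sup>2 * (\<Sum>j\<in>S. Q j \<rho>) < V" .
  qed
  also have "\<dots> \<le> scale_count N * V" using cG V by simp
  finally show False using big unfolding V_def by simp
qed

text \<open>A rectangle makes angle zero with itself, so its scale is its width and the overlap is
  its full area. Points of kept rectangles find their mass in this way.\<close>

lemma exists_mass_near_self:
  assumes e: "norm e = 1" and b: "0 < b" "b \<le> a" and x: "x \<in> orect e d a b"
  shows "b\<^sup>2 / 4 \<le> measure lebesgue (orect e d (3 * a) (3 * b) \<inter> ball x (9 * b))"
proof -
  have "measure lebesgue (orect e d a b \<inter> orect e d a b) * b\<^sup>2
    \<le> 4 * measure lebesgue (orect e d a b) * measure lebesgue (orect e d (3 * a) (3 * b) \<inter> ball x (9 * b))"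
    using assms by (intro measure_orect_inter_le) auto
  moreover have "measure lebesgue (orect e d a b) > 0" using e b by (simp add: measure_orect)
  ultimately show ?thesis by (simp add: mult.assoc mult.left_commute[of 4])
qed

section \<open>Greedy selection\<close>

text \<open>The decision on \<open>k\<close> looks only at smaller indices, so extending the list
  never revises it. Both directions of the equivalence matter: kept indices have small overlap with
  their predecessors, rejected ones have large overlap.\<close>

lemma exists_greedy_selection:
  fixes m :: "nat \<Rightarrow> nat \<Rightarrow> real" and t :: "nat \<Rightarrow> real"
  obtains S where "S \<subseteq> {..<n}" "\<And>k. k < n \<Longrightarrow> k \<in> S \<longleftrightarrow> (\<Sum>j\<in>S \<inter> {..<k}. m j k) \<le> t k"
proof -
  have "\<exists>S\<subseteq>{..<n}. \<forall>k<n. k \<in> S \<longleftrightarrow> (\<Sum>j\<in>S \<inter> {..<k}. m j k) \<le> t k"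
  proof (induction n)
    case 0
    then show ?case by simp
  next
    case (Suc n)
    then obtain S where S: "S \<subseteq> {..<n}" "\<And>k. k < n \<Longrightarrow> k \<in> S \<longleftrightarrow> (\<Sum>j\<in>S \<inter> {..<k}. m j k) \<le> t k"
      by blast
    define S' where "S' = (if (\<Sum>j\<in>S. m j n) \<le> t n then insert n S else S)"
    have n: "n \<notin> S" using S(1) by auto
    have Sk: "S' \<inter> {..<k} = S \<inter> {..<k}" if "k < n" for k
      using S(1) that by (auto simp: S'_def)
    have Sn: "S' \<inter> {..<n} = S" using S(1) by (auto simp: S'_def)
    have "k \<in> S' \<longleftrightarrow> (\<Sum>j\<in>S' \<inter> {..<k}. m j k) \<le> t k" if "k < Suc n" for k
    proof (cases "k = n")
      case True
      then show ?thesis using n by (simp add: Sn) (simp add: S'_def)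
    next
      case False
      then have "k < n" using that by simp
      then show ?thesis using S(2)[of k] by (simp add: Sk) (auto simp: S'_def)
    qed
    moreover have "S' \<subseteq> {..<Suc n}" using S(1) by (auto simp: S'_def)
    ultimately show ?case by blast
  qed
  then show ?thesis using that by blast
qed

section \<open>Lower semicontinuity and measurability of maximal operators\<close>

text \<open>The common property of squares and directional rectangles that lets a set of the family
  be enlarged slightly within the family, so that its points become interior points.\<close>

definition dilation_closed :: "(real^2) set set \<Rightarrow> bool" where
  "dilation_closed \<B> \<longleftrightarrow> (\<forall>R\<in>\<B>. \<exists>e c A B. R = orect e c A B \<and> norm e = 1 \<and> 0 < A \<and> 0 < B \<and>
     (\<forall>t\<ge>1. orect e c (t * A) (t * B) \<in> \<B>))"

lemma dilation_closed_squares: "dilation_closed squares"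
  unfolding dilation_closed_def
proof
  fix R assume "R \<in> squares"
  then obtain e c A where R: "R = orect e c A A" "norm e = 1" "0 < A" unfolding squares_eq by blast
  have "orect e c (t * A) (t * A) \<in> squares" if "1 \<le> t" for t
    unfolding squares_eq mem_Collect_eq using that R
    by (intro exI[of _ e] exI[of _ c] exI[of _ "t * A"]) auto
  then show "\<exists>e c A B. R = orect e c A B \<and> norm e = 1 \<and> 0 < A \<and> 0 < B \<and> (\<forall>t\<ge>1. orect e c (t * A) (t * B) \<in> squares)"
    using R by blast
qed

lemma dilation_closed_directional:
  assumes "\<And>\<sigma>. \<sigma> \<in> \<Sigma> \<Longrightarrow> norm \<sigma> = 1"
  shows "dilation_closed (directional_rectangles \<Sigma>)"
  unfolding dilation_closed_def
proof
  have eq: "directional_rectangles \<Sigma> = {orect \<sigma> c A B | \<sigma> c A B. \<sigma> \<in> \<Sigma> \<and> 0 < B \<and> B \<le> A}"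
    using assms by (rule directional_rectangles_eq)
  fix R assume "R \<in> directional_rectangles \<Sigma>"
  then obtain e c A B where R: "R = orect e c A B" "e \<in> \<Sigma>" "0 < B" "B \<le> A" unfolding eq by blast
  have "orect e c (t * A) (t * B) \<in> directional_rectangles \<Sigma>" if "1 \<le> t" for t
    unfolding eq mem_Collect_eq using that R
    by (intro exI[of _ e] exI[of _ c] exI[of _ "t * A"] exI[of _ "t * B"]) auto
  then show "\<exists>e c A B. R = orect e c A B \<and> norm e = 1 \<and> 0 < A \<and> 0 < B \<and>
      (\<forall>t\<ge>1. orect e c (t * A) (t * B) \<in> directional_rectangles \<Sigma>)"
    using R assms[of e] by (intro exI[of _ e] exI[of _ c] exI[of _ A] exI[of _ B]) auto
qed

lemma orect_subset_interior:
  assumes "A < A'" "B < B'"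
  shows "orect e c A B \<subseteq> interior (orect e c A' B')"
proof (rule order_trans)
  show "orect e c A B \<subseteq> {y. \<bar>(y - c) \<bullet> e\<bar> < A' \<and> \<bar>(y - c) \<bullet> perp e\<bar> < B'}"
    using assms by (auto simp: orect_def)
  have "open ({y. \<bar>(y - c) \<bullet> e\<bar> < A'} \<inter> {y. \<bar>(y - c) \<bullet> perp e\<bar> < B'})"
    by (intro open_Int open_Collect_less continuous_intros)
  then have "open {y. \<bar>(y - c) \<bullet> e\<bar> < A' \<and> \<bar>(y - c) \<bullet> perp e\<bar> < B'}"
    by (simp add: Collect_conj_eq)
  then show "{y. \<bar>(y - c) \<bullet> e\<bar> < A' \<and> \<bar>(y - c) \<bullet> perp e\<bar> < B'} \<subseteq> interior (orect e c A' B')"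
    by (rule interior_maximal[rotated]) (auto simp: orect_def)
qed

lemma less_maximal_operator_iff:
  "a < maximal_operator \<B> g x \<longleftrightarrow>
    (\<exists>R\<in>\<B>. x \<in> R \<and> a < (\<integral>\<^sup>+y\<in>R. g y \<partial>lebesgue) / emeasure lebesgue R)"
  unfolding maximal_operator_def less_SUP_iff by (auto split: split_indicator simp: indicator_def)

text \<open>A strict inequality survives a small increase of the area, which is what dilation by
  \<open>t\<close> in both directions causes.\<close>

lemma ennreal_less_divide_dilate:
  fixes a I :: ennreal and V :: real
  assumes V: "V > 0" and a: "a < I / ennreal V"
  obtains t :: real where "1 < t" "a < I / ennreal (t\<^sup>2 * V)"
proof (cases I)
  case (real i)
  have Vi: "I / ennreal V = ennreal (i / V)" using real V by (simp add: divide_ennreal)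
  with a obtain \<alpha> where \<alpha>: "a = ennreal \<alpha>" "0 \<le> \<alpha>" by (cases a) auto
  then have "\<alpha> < i / V" using a Vi by (simp add: ennreal_less_iff)
  then obtain \<beta> where \<beta>: "\<alpha> < \<beta>" "\<beta> < i / V" using dense by blast
  \<comment> \<open>With this choice the quotient after dilation is exactly the intermediate value
    \<open>\<beta>\<close>.\<close>
  define t where "t = sqrt (i / V / \<beta>)"
  have b0: "\<beta> > 0" using \<alpha> \<beta> by simp
  have t: "1 < t" using \<beta>(2) b0 unfolding t_def real_sqrt_gt_1_iff by (simp only: less_divide_eq_1_pos)
  have t2: "t\<^sup>2 = i / V / \<beta>" using b0 V real by (simp add: t_def)
  have "i > 0" using b0 \<beta> V by (meson less_trans zero_less_divide_iff not_less_iff_gr_or_eq)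
  then have "i / (t\<^sup>2 * V) = \<beta>" using b0 V by (simp add: t2)
  moreover have "I / ennreal (t\<^sup>2 * V) = ennreal (i / (t\<^sup>2 * V))"
    using real V t by (simp add: divide_ennreal)
  ultimately have "a < I / ennreal (t\<^sup>2 * V)" using \<alpha> \<beta> by (simp add: ennreal_less_iff)
  then show ?thesis using that t by blast
next
  case top
  then have "I / ennreal (2\<^sup>2 * V) = \<infinity>" by (simp add: ennreal_divide_eq_top_iff ennreal_top_divide)
  moreover have "a < \<infinity>" using order.strict_trans2[OF a top_greatest] by simp
  ultimately show ?thesis using that[of 2] by simp
qed

text \<open>A slightly larger concentric rectangle has at least the same integral and still a large
  enough mean. This gives lower semicontinuity of the maximal function and also open covers of its
  superlevel sets.\<close>

lemma less_maximal_operator_interior: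
  assumes "dilation_closed \<B>" and "a < maximal_operator \<B> g x"
  obtains R where "R \<in> \<B>" "x \<in> interior R" "a < (\<integral>\<^sup>+y\<in>R. g y \<partial>lebesgue) / emeasure lebesgue R"
proof -
  obtain R where R: "R \<in> \<B>" "x \<in> R" "a < (\<integral>\<^sup>+y\<in>R. g y \<partial>lebesgue) / emeasure lebesgue R"
    using assms(2) unfolding less_maximal_operator_iff by blast
  then obtain e c A B where e: "R = orect e c A B" "norm e = 1" "0 < A" "0 < B"
    "\<And>t. t \<ge> 1 \<Longrightarrow> orect e c (t * A) (t * B) \<in> \<B>" using assms(1) unfolding dilation_closed_def by metis
  have "a < (\<integral>\<^sup>+y\<in>R. g y \<partial>lebesgue) / ennreal (4 * A * B)" using R(3) e by (simp add: emeasure_orect)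
  then obtain t where t: "1 < t" "a < (\<integral>\<^sup>+y\<in>R. g y \<partial>lebesgue) / ennreal (t\<^sup>2 * (4 * A * B))"
    using ennreal_less_divide_dilate[of "4 * A * B" a] e by auto
  define R' where "R' = orect e c (t * A) (t * B)"
  have sub: "R \<subseteq> interior R'" unfolding e(1) R'_def using e t by (intro orect_subset_interior) auto
  then have "(\<integral>\<^sup>+y\<in>R. g y \<partial>lebesgue) \<le> (\<integral>\<^sup>+y\<in>R'. g y \<partial>lebesgue)"
    using interior_subset[of R'] by (intro nn_integral_mono) (auto split: split_indicator)
  moreover have "emeasure lebesgue R' = ennreal (t\<^sup>2 * (4 * A * B))"
    using e t by (simp add: R'_def emeasure_orect power2_eq_square mult_ac)
  ultimately have "a < (\<integral>\<^sup>+y\<in>R'. g y \<partial>lebesgue) / emeasure lebesgue R'"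
    using t(2) by (simp add: less_le_trans divide_right_mono_ennreal)
  then show ?thesis using that[of R'] e(5)[of t] t sub R(2) by (auto simp: R'_def)
qed

lemma open_maximal_operator_greater:
  assumes "dilation_closed \<B>"
  shows "open {x. a < maximal_operator \<B> g x}"
proof -
  have "\<exists>T. open T \<and> x \<in> T \<and> T \<subseteq> {x. a < maximal_operator \<B> g x}"
    if x: "a < maximal_operator \<B> g x" for x
  proof -
    obtain R where R: "R \<in> \<B>" "x \<in> interior R" "a < (\<integral>\<^sup>+y\<in>R. g y \<partial>lebesgue) / emeasure lebesgue R"
      using less_maximal_operator_interior[OF assms x] .
    have "interior R \<subseteq> {x. a < maximal_operator \<B> g x}"
      unfolding less_maximal_operator_iff using R(1,3) interior_subset[of R] by blast
    then show ?thesis using R(2) open_interior by blast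
  qed
  then show ?thesis by (subst open_subopen) simp
qed

lemma borel_measurable_maximal_operator:
  assumes "dilation_closed \<B>"
  shows "maximal_operator \<B> g \<in> borel_measurable lebesgue"
proof (rule borel_measurableI_greater)
  fix a
  have "{x. a < maximal_operator \<B> g x} \<in> sets borel"
    using open_maximal_operator_greater[OF assms] by (rule borel_open)
  then show "{x \<in> space lebesgue. a < maximal_operator \<B> g x} \<in> sets lebesgue" by simp
qed

lemma hl_maximal_measurable [measurable]: "hl_maximal w \<in> borel_measurable lebesgue"
  unfolding hl_maximal_def by (rule borel_measurable_maximal_operator[OF dilation_closed_squares])

lemma directional_maximal_measurable:
  assumes "\<And>\<sigma>. \<sigma> \<in> \<Sigma> \<Longrightarrow> norm \<sigma> = 1"
  shows "directional_maximal \<Sigma> g \<in> borel_measurable lebesgue"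
  unfolding directional_maximal_def
  by (intro borel_measurable_maximal_operator dilation_closed_directional assms)

lemma maximal_operator_ge:
  assumes "R \<in> \<B>" "x \<in> R"
  shows "(\<integral>\<^sup>+y\<in>R. g y \<partial>lebesgue) / emeasure lebesgue R \<le> maximal_operator \<B> g x"
  unfolding maximal_operator_def using assms by (intro SUP_upper2[of R]) auto

section \<open>Replacing the weight by its maximal function through a Vitali covering\<close>

lemma ball_subset_orect:
  assumes "norm e = 1"
  shows "ball x r \<subseteq> orect e x r r"
proof
  fix y assume "y \<in> ball x r"
  then have "norm (y - x) \<le> r" by (simp add: dist_norm norm_minus_commute)
  then show "y \<in> orect e x r r"
    using Cauchy_Schwarz_ineq2[of "y - x" e] Cauchy_Schwarz_ineq2[of "y - x" "perp e"] assms
    by (simp add: orect_def)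
qed

text \<open>The denominator is the area of the square of side \<open>2 * r\<close> circumscribed
  about the ball.\<close>

lemma hl_maximal_ge_ball:
  assumes "0 < r" "y \<in> ball x r"
  shows "(\<integral>\<^sup>+z\<in>ball x r. w z \<partial>lebesgue) / ennreal (4 * r\<^sup>2) \<le> hl_maximal w y"
proof -
  define e :: "real^2" where "e = axis 1 1"
  have e: "norm e = 1" by (simp add: e_def)
  define Q where "Q = orect e x r r"
  have sub: "ball x r \<subseteq> Q" using ball_subset_orect[OF e] by (simp add: Q_def)
  have Q: "Q \<in> squares" unfolding squares_eq Q_def mem_Collect_eq using e assms(1)
    by (intro exI[of _ e] exI[of _ x] exI[of _ r]) auto
  have "emeasure lebesgue Q = ennreal (4 * r\<^sup>2)"
    using assms(1) e by (simp add: Q_def emeasure_orect power2_eq_square mult.assoc)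
  moreover have "(\<integral>\<^sup>+z\<in>ball x r. w z \<partial>lebesgue) \<le> (\<integral>\<^sup>+z\<in>Q. w z \<partial>lebesgue)"
    using sub by (intro nn_integral_mono) (auto split: split_indicator)
  ultimately have "(\<integral>\<^sup>+z\<in>ball x r. w z \<partial>lebesgue) / ennreal (4 * r\<^sup>2)
      \<le> (\<integral>\<^sup>+z\<in>Q. w z \<partial>lebesgue) / emeasure lebesgue Q" by (simp add: divide_right_mono_ennreal)
  also have "\<dots> \<le> hl_maximal w y"
    unfolding hl_maximal_def using Q sub assms(2) by (intro maximal_operator_ge) auto
  finally show ?thesis .
qed

text \<open>At most one of the sets contains \<open>y\<close>. The sum is written as an integral
  over \<open>count_space\<close> so that it can be exchanged with a Lebesgue integral when
  \<open>C\<close> is countable.\<close>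

lemma nn_integral_count_indicator_disjoint_le:
  assumes "pairwise (\<lambda>i j. disjnt (B i) (B j)) C"
  shows "(\<integral>\<^sup>+i. c * indicator (B i) y \<partial>count_space C) \<le> (c :: ennreal)"
proof (cases "\<exists>i\<in>C. y \<in> B i")
  case True
  then obtain k where k: "k \<in> C" "y \<in> B k" by blast
  have "(\<integral>\<^sup>+i. c * indicator (B i) y \<partial>count_space C) = (\<integral>\<^sup>+i. c * indicator {k} i \<partial>count_space C)"
  proof (intro nn_integral_cong)
    fix i assume "i \<in> space (count_space C)"
    then have "i \<noteq> k \<Longrightarrow> y \<notin> B i" using assms k by (auto simp: pairwise_def disjnt_iff)
    then show "c * indicator (B i) y = c * indicator {k} i" using k by (cases "i = k") auto
  qed
  also have "\<dots> = c" using k by (simp add: nn_integral_cmult_indicator)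
  finally show ?thesis by simp
next
  case False
  then have "(\<integral>\<^sup>+i. c * indicator (B i) y \<partial>count_space C) = (\<integral>\<^sup>+i. 0 \<partial>count_space C)"
    by (intro nn_integral_cong) auto
  then show ?thesis by simp
qed

text \<open>Choose disjoint balls whose fivefold dilates cover \<open>U\<close>; the bound
  \<open>K\<close> on the radii is what Vitali's lemma requires. On each chosen ball
  \<open>hl_maximal w\<close> is at least the integral of \<open>w\<close> over the fivefold ball
  divided by \<open>100 * (r i)\<^sup>2\<close>, the area of the square about it. The mass of
  \<open>F\<close> in the ball cancels this denominator.\<close>

lemma nn_integral_le_maximal_dual:
  fixes F w :: "real^2 \<Rightarrow> ennreal"
  assumes [measurable]: "F \<in> borel_measurable lebesgue" "w \<in> borel_measurable lebesgue"
    and c: "0 < c"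
    and U: "\<And>x. x \<in> U \<Longrightarrow> \<exists>\<rho>>0. \<rho> \<le> K \<and> ennreal (100 * c * \<rho>\<^sup>2) \<le> (\<integral>\<^sup>+y\<in>ball x \<rho>. F y \<partial>lebesgue)"
  shows "ennreal c * (\<integral>\<^sup>+x\<in>U. w x \<partial>lebesgue) \<le> (\<integral>\<^sup>+x. F x * hl_maximal w x \<partial>lebesgue)"
proof -
  obtain r where r: "\<And>x. x \<in> U \<Longrightarrow> 0 < r x \<and> r x \<le> K"
    and mass: "\<And>x. x \<in> U \<Longrightarrow> ennreal (100 * c * (r x)\<^sup>2) \<le> (\<integral>\<^sup>+y\<in>ball x (r x). F y \<partial>lebesgue)"
    using U by metis
  have "U \<subseteq> (\<Union>x\<in>U. ball x (r x))" using r by force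
  then obtain C where C: "countable C" "C \<subseteq> U" "pairwise (\<lambda>i j. disjnt (ball i (r i)) (ball j (r j))) C"
    "U \<subseteq> (\<Union>x\<in>C. ball x (5 * r x))"
    using Vitali_covering_lemma_balls[of U "\<lambda>x. x" r U K] r by blast
  define h where "h = hl_maximal w"
  have [measurable]: "h \<in> borel_measurable lebesgue" by (simp add: h_def)
  have [measurable]: "ball x s \<in> sets lebesgue" for x :: "real^2" and s by simp
  have one: "ennreal c * (\<integral>\<^sup>+x\<in>ball i (5 * r i). w x \<partial>lebesgue)
      \<le> (\<integral>\<^sup>+y. F y * h y * indicator (ball i (r i)) y \<partial>lebesgue)" if i: "i \<in> C" for i
  proof -
    define I where "I = (\<integral>\<^sup>+x\<in>ball i (5 * r i). w x \<partial>lebesgue)"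
    have ri: "0 < r i" and iU: "i \<in> U" using r C i by auto
    define q where "q = I / ennreal (100 * (r i)\<^sup>2)"
    have h: "q \<le> h y" if "y \<in> ball i (r i)" for y
    proof -
      have "y \<in> ball i (5 * r i)" using that ri by auto
      then show ?thesis using hl_maximal_ge_ball[of "5 * r i" y i w] ri
        by (simp add: q_def I_def h_def power_mult_distrib)
    qed
    have "ennreal (100 * (r i)\<^sup>2) * q = I"
      unfolding q_def using ri by (simp add: ennreal_times_divide mult_divide_eq_ennreal mult.commute[of _ I])
    then have "ennreal c * I = ennreal c * (ennreal (100 * (r i)\<^sup>2) * q)" by simp
    also have "\<dots> = ennreal (100 * c * (r i)\<^sup>2) * q"
      using c ri by (simp add: ennreal_mult[symmetric] mult_ac flip: mult.assoc)
    also have "\<dots> \<le> (\<integral>\<^sup>+y\<in>ball i (r i). F y \<partial>lebesgue) * q"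
      by (intro mult_right_mono mass iU) simp
    also have "\<dots> = (\<integral>\<^sup>+y. F y * indicator (ball i (r i)) y * q \<partial>lebesgue)"
      by (rule nn_integral_multc[symmetric]) measurable
    also have "\<dots> \<le> (\<integral>\<^sup>+y. F y * h y * indicator (ball i (r i)) y \<partial>lebesgue)"
      using h by (intro nn_integral_mono) (auto split: split_indicator intro!: mult_left_mono)
    finally show ?thesis by (simp add: I_def)
  qed
  have "(\<integral>\<^sup>+x\<in>U. w x \<partial>lebesgue) \<le> (\<integral>\<^sup>+x. \<integral>\<^sup>+i. w x * indicator (ball i (5 * r i)) x \<partial>count_space C \<partial>lebesgue)"
  proof (intro nn_integral_mono)
    fix x
    show "w x * indicator U x \<le> (\<integral>\<^sup>+i. w x * indicator (ball i (5 * r i)) x \<partial>count_space C)"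
    proof (cases "x \<in> U")
      case True
      then obtain k where k: "k \<in> C" "x \<in> ball k (5 * r k)" using C(4) by blast
      have "w x = (\<integral>\<^sup>+i. w x * indicator {k} i \<partial>count_space C)"
        using k by (simp add: nn_integral_cmult_indicator)
      also have "\<dots> \<le> (\<integral>\<^sup>+i. w x * indicator (ball i (5 * r i)) x \<partial>count_space C)"
        using k by (intro nn_integral_mono) (auto split: split_indicator)
      finally show ?thesis using True by simp
    qed simp
  qed
  also have "\<dots> = (\<integral>\<^sup>+i. \<integral>\<^sup>+x. w x * indicator (ball i (5 * r i)) x \<partial>lebesgue \<partial>count_space C)"
    by (intro nn_integral_count_space_nn_integral C) measurable
  finally have "ennreal c * (\<integral>\<^sup>+x\<in>U. w x \<partial>lebesgue)
      \<le> ennreal c * (\<integral>\<^sup>+i. \<integral>\<^sup>+x. w x * indicator (ball i (5 * r i)) x \<partial>lebesgue \<partial>count_space C)"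
    by (intro mult_left_mono) auto
  also have "\<dots> = (\<integral>\<^sup>+i. ennreal c * (\<integral>\<^sup>+x. w x * indicator (ball i (5 * r i)) x \<partial>lebesgue) \<partial>count_space C)"
    by (rule nn_integral_cmult[symmetric]) simp
  also have "\<dots> \<le> (\<integral>\<^sup>+i. \<integral>\<^sup>+y. F y * h y * indicator (ball i (r i)) y \<partial>lebesgue \<partial>count_space C)"
    using one by (intro nn_integral_mono) auto
  also have "\<dots> = (\<integral>\<^sup>+y. \<integral>\<^sup>+i. F y * h y * indicator (ball i (r i)) y \<partial>count_space C \<partial>lebesgue)"
    by (intro nn_integral_count_space_nn_integral[symmetric] C) measurable
  also have "\<dots> \<le> (\<integral>\<^sup>+y. F y * h y \<partial>lebesgue)"
    using C(3) by (intro nn_integral_mono nn_integral_count_indicator_disjoint_le)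
  finally show ?thesis by (simp add: h_def)
qed

section \<open>The duality argument for sparse families\<close>

text \<open>In the expanded square the mixed terms occur twice and the diagonal ones once, so pairs
  with \<open>j \<le> k\<close> suffice up to a factor 2. A selection rule that looks only at
  predecessors controls exactly these pairs.\<close>

lemma sum_squared_le_ordered_pairs:
  fixes a :: "'i::linorder \<Rightarrow> real"
  assumes "finite S" "\<And>j. j \<in> S \<Longrightarrow> 0 \<le> a j"
  shows "(\<Sum>j\<in>S. a j)\<^sup>2 \<le> 2 * (\<Sum>k\<in>S. a k * (\<Sum>j\<in>S \<inter> {..k}. a j))"
  using assms
proof (induction S rule: finite_linorder_max_induct)
  case (insert b S)
  have b: "b \<notin> S" using insert by blast
  have 1: "insert b S \<inter> {..k} = S \<inter> {..k}" if "k \<in> S" for k using insert that by fastforce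
  have 2: "insert b S \<inter> {..b} = insert b S" using insert by fastforce
  have "(\<Sum>j\<in>insert b S. a j)\<^sup>2 = (\<Sum>j\<in>S. a j)\<^sup>2 + 2 * (a b * (\<Sum>j\<in>S. a j)) + (a b)\<^sup>2"
    using b insert(1) by (simp add: power2_sum)
  also have "\<dots> \<le> 2 * (\<Sum>k\<in>S. a k * (\<Sum>j\<in>S \<inter> {..k}. a j)) + 2 * (a b * (\<Sum>j\<in>S. a j)) + 2 * (a b)\<^sup>2"
    using insert.IH insert.prems by (intro add_mono) auto
  also have "\<dots> = 2 * (\<Sum>k\<in>insert b S. a k * (\<Sum>j\<in>insert b S \<inter> {..k}. a j))"
    using b insert(1) by (simp add: 1 2 power2_eq_square algebra_simps)
  finally show ?case .
qed simp

text \<open>Duality: the weighted sum \<open>X\<close> is at most \<open>\<integral> g \<Sum> v\<^sub>j 1\<^sub>j / L\<close>, and Cauchy-Schwarz against \<open>W\<close>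
  reproduces \<open>X\<close> because the square of \<open>\<Sum> v\<^sub>j 1\<^sub>j\<close> is controlled by the overlaps with earlier sets.\<close>
lemma sparse_weighted_sum_le:
  fixes R :: "nat \<Rightarrow> 'a set" and v :: "nat \<Rightarrow> ennreal" and g W :: "'a \<Rightarrow> ennreal"
  assumes S: "finite S" and R: "\<And>j. j \<in> S \<Longrightarrow> R j \<in> fmeasurable M"
    and [measurable]: "g \<in> borel_measurable M" "W \<in> borel_measurable M"
    and fin: "\<And>x. g x < \<infinity>" and L: "0 < L" and T: "0 \<le> T"
    and v: "\<And>j x. j \<in> S \<Longrightarrow> x \<in> R j \<Longrightarrow> v j \<le> W x"
    and pos: "\<And>j. j \<in> S \<Longrightarrow> 0 < measure M (R j)"
    and avg: "\<And>j. j \<in> S \<Longrightarrow> ennreal (L * measure M (R j)) \<le> (\<integral>\<^sup>+x\<in>R j. g x \<partial>M)"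
    and sparse: "\<And>k. k \<in> S \<Longrightarrow> (\<Sum>j\<in>S \<inter> {..k}. measure M (R j \<inter> R k)) \<le> T * measure M (R k)"
  shows "ennreal (L\<^sup>2) * (\<Sum>j\<in>S. v j * emeasure M (R j)) \<le> ennreal (2 * T) * (\<integral>\<^sup>+x. (g x)\<^sup>2 * W x \<partial>M)"
proof (cases "S = {}")
  case True
  then show ?thesis by simp
next
  case False
  define J where "J = (\<integral>\<^sup>+x. (g x)\<^sup>2 * W x \<partial>M)"
  have [measurable]: "R j \<in> sets M" if "j \<in> S" for j using R[OF that] by blast
  have T0: "0 < T"
  \<comment> \<open>The sum in \<open>sparse\<close> contains the full overlap of \<open>R k\<close>
    with itself, so \<open>T\<close> cannot vanish; it is needed as a divisor later.\<close>
  proof -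
    obtain k where k: "k \<in> S" using False by blast
    have "measure M (R k \<inter> R k) \<le> (\<Sum>j\<in>S \<inter> {..k}. measure M (R j \<inter> R k))"
      using S k by (intro member_le_sum[of k]) auto
    then have "measure M (R k) \<le> T * measure M (R k)" using sparse[OF k] by simp
    then show ?thesis using pos[OF k] T by (cases "T = 0") auto
  qed
  show ?thesis
  proof (cases "J = \<infinity>")
    case True
    then show ?thesis using T0 unfolding J_def[symmetric] by (simp add: ennreal_mult_eq_top_iff ennreal_mult_top)
  next
    case J: False
    \<comment> \<open>An infinite \<open>v j\<close> makes \<open>W\<close> infinite on
      \<open>R j\<close>. As \<open>J\<close> is finite, \<open>g\<close> then vanishes almost
      everywhere on \<open>R j\<close>, against its positive mean. Finiteness is essential, because
      \<open>X\<close> is later absorbed into the left-hand side.\<close>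
    have vfin: "v j < \<infinity>" if j: "j \<in> S" for j
    proof (rule ccontr)
      assume "\<not> v j < \<infinity>"
      then have vt: "v j = \<infinity>" by (simp add: less_top[symmetric] infinity_ennreal_def)
      have "(\<integral>\<^sup>+x. (g x)\<^sup>2 * W x \<partial>M) \<noteq> \<infinity>" using J by (simp add: J_def)
      then have "AE x in M. (g x)\<^sup>2 * W x \<noteq> \<infinity>" by (intro nn_integral_PInf_AE) measurable
      then have "AE x in M. g x * indicator (R j) x = 0"
      proof eventually_elim
        case (elim x)
        show ?case
        proof (cases "x \<in> R j")
          case True
          then have "W x = \<infinity>" using v[OF j True] vt by (simp add: top_unique infinity_ennreal_def)
          then show ?thesis using elim by (auto simp: ennreal_mult_eq_top_iff power_eq_0_iff)
        qed simp
      qed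
      then have "(\<integral>\<^sup>+x\<in>R j. g x \<partial>M) = 0" using j by (subst nn_integral_0_iff_AE) auto
      then show False using avg[OF j] mult_pos_pos[OF L pos[OF j]] by (simp add: ennreal_eq_0_iff)
    qed
    define a where "a j = enn2real (v j)" for j
    have va: "v j = ennreal (a j)" if "j \<in> S" for j using vfin[OF that] by (simp add: a_def)
    have a0: "0 \<le> a j" for j by (simp add: a_def)
    define X where "X = (\<Sum>j\<in>S. a j * measure M (R j))"
    have X0: "0 \<le> X" using a0 by (auto simp: X_def intro!: sum_nonneg)
    have X: "(\<Sum>j\<in>S. v j * emeasure M (R j)) = ennreal X"
    proof -
      have "(\<Sum>j\<in>S. v j * emeasure M (R j)) = (\<Sum>j\<in>S. ennreal (a j * measure M (R j)))"
        using a0 R by (intro sum.cong refl) (simp add: va ennreal_mult emeasure_eq_measure2)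
      also have "\<dots> = ennreal X" unfolding X_def using a0 by (intro sum_ennreal) auto
      finally show ?thesis .
    qed
    \<comment> \<open>Each pair carries only the coefficient of its larger index. The other
      coefficient is estimated by \<open>W x\<close>, which produces the factor \<open>m\<close> in
      the bound for \<open>G\<^sup>2\<close> below.\<close>
    define H where "H x = (\<Sum>k\<in>S. a k * (indicator (R k) x * (\<Sum>j\<in>S \<inter> {..k}. indicator (R j) x)))" for x
    \<comment> \<open>Chosen so that the term with \<open>T * X\<close> below becomes half of
      \<open>L * X\<close>.\<close>
    define \<epsilon> where "\<epsilon> = T / L"
    have e0: "0 < \<epsilon>" using T0 L by (simp add: \<epsilon>_def)
    have ennreal_comb: "ennreal (\<epsilon> * p + \<kappa> * q) = ennreal \<epsilon> * ennreal p + ennreal \<kappa> * ennreal q"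
      if "0 \<le> \<kappa>" "0 \<le> p" "0 \<le> q" for \<kappa> p q
      using that e0 by (simp add: ennreal_plus ennreal_mult)
    have H0: "0 \<le> H x" for x using a0 by (auto simp: H_def intro!: sum_nonneg mult_nonneg_nonneg)
    \<comment> \<open>Young's inequality with parameter \<open>\<epsilon> * W x\<close>. Since this
      divides by \<open>W x\<close>, the values zero and infinity are treated separately.\<close>
    have pt: "(\<Sum>j\<in>S. ennreal (a j) * (g x * indicator (R j) x))
        \<le> ennreal \<epsilon> * ((g x)\<^sup>2 * W x) + ennreal (1 / (2 * \<epsilon>)) * ennreal (H x)" for x
    proof -
      obtain \<gamma> where \<gamma>: "g x = ennreal \<gamma>" "0 \<le> \<gamma>" using fin[of x] by (cases "g x") auto
      define G where "G = (\<Sum>j\<in>S. a j * indicator (R j) x)"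
      have G0: "0 \<le> G" using a0 by (auto simp: G_def intro!: sum_nonneg)
      have lhs: "(\<Sum>j\<in>S. ennreal (a j) * (g x * indicator (R j) x)) = ennreal (\<gamma> * G)"
      proof -
        have "(\<Sum>j\<in>S. ennreal (a j) * (g x * indicator (R j) x)) = (\<Sum>j\<in>S. ennreal (\<gamma> * (a j * indicator (R j) x)))"
          using a0 \<gamma> by (intro sum.cong refl) (auto simp: ennreal_mult mult_ac split: split_indicator)
        also have "\<dots> = ennreal (\<gamma> * G)"
          unfolding G_def sum_distrib_left using a0 \<gamma> by (intro sum_ennreal) auto
        finally show ?thesis .
      qed
      show ?thesis
      proof (cases "W x")
        case (real m)
        have am: "a j * indicator (R j) x \<le> m * indicator (R j) x" if "j \<in> S" for j
          using v[OF that, of x] va[OF that] real ennreal_le_iff[of m "a j"] by (cases "x \<in> R j") auto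
        have "G\<^sup>2 \<le> 2 * (\<Sum>k\<in>S. a k * indicator (R k) x * (\<Sum>j\<in>S \<inter> {..k}. a j * indicator (R j) x))"
          unfolding G_def using S a0 by (intro sum_squared_le_ordered_pairs) auto
        also have "\<dots> \<le> 2 * (\<Sum>k\<in>S. a k * indicator (R k) x * (\<Sum>j\<in>S \<inter> {..k}. m * indicator (R j) x))"
          using am a0 by (intro mult_left_mono sum_mono) auto
        also have "\<dots> = 2 * m * H x"
          unfolding H_def sum_distrib_left by (intro sum.cong refl) (simp add: mult_ac)
        finally have G2: "G\<^sup>2 \<le> 2 * m * H x" .
        have "\<gamma> * G \<le> \<epsilon> * (\<gamma>\<^sup>2 * m) + 1 / (2 * \<epsilon>) * H x"
        proof (cases "m = 0")
          case True
          then have "G = 0" using G2 by simp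
          then show ?thesis using True e0 H0 by simp
        next
          case False
          then have m: "0 < m" using real by simp
          have "0 \<le> (2 * \<epsilon> * m * \<gamma> - G)\<^sup>2" by simp
          also have "\<dots> \<le> 4 * \<epsilon>\<^sup>2 * m\<^sup>2 * \<gamma>\<^sup>2 - 4 * \<epsilon> * m * (\<gamma> * G) + 2 * m * H x"
            using G2 by (simp add: power2_diff power_mult_distrib)
          also have "\<dots> = 4 * \<epsilon> * m * (\<epsilon> * (\<gamma>\<^sup>2 * m) + 1 / (2 * \<epsilon>) * H x - \<gamma> * G)"
            using e0 by (simp add: field_simps power2_eq_square)
          finally have "0 \<le> 4 * \<epsilon> * m * (\<epsilon> * (\<gamma>\<^sup>2 * m) + 1 / (2 * \<epsilon>) * H x - \<gamma> * G)" .
          moreover have "0 < 4 * \<epsilon> * m" using m e0 by simp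
          ultimately have "0 \<le> \<epsilon> * (\<gamma>\<^sup>2 * m) + 1 / (2 * \<epsilon>) * H x - \<gamma> * G"
            by (meson mult_pos_neg not_le)
          then show ?thesis by linarith
        qed
        then have "ennreal (\<gamma> * G) \<le> ennreal (\<epsilon> * (\<gamma>\<^sup>2 * m) + 1 / (2 * \<epsilon>) * H x)" by (rule ennreal_leI)
        also have "\<dots> = ennreal \<epsilon> * ((g x)\<^sup>2 * W x) + ennreal (1 / (2 * \<epsilon>)) * ennreal (H x)"
          using ennreal_comb[of "1 / (2 * \<epsilon>)" "\<gamma>\<^sup>2 * m" "H x"] real \<gamma> e0 H0
          by (simp add: ennreal_mult ennreal_power)
        finally show ?thesis unfolding lhs .
      next
        case top
        show ?thesis
        proof (cases "\<gamma> = 0")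
          case True
          then show ?thesis using lhs by simp
        next
          case False
          then have "(g x)\<^sup>2 * W x = \<infinity>" using top \<gamma> by (simp add: ennreal_mult_eq_top_iff ennreal_power ennreal_mult_top)
          then have "ennreal \<epsilon> * ((g x)\<^sup>2 * W x) = \<infinity>" using e0 by (simp add: ennreal_mult_eq_top_iff ennreal_mult_top)
          then show ?thesis by simp
        qed
      qed
    qed
    have IH: "(\<integral>\<^sup>+x. ennreal (H x) \<partial>M) \<le> ennreal (T * X)"
    proof -
      have "(\<integral>\<^sup>+x. ennreal (H x) \<partial>M) = (\<integral>\<^sup>+x. (\<Sum>k\<in>S. ennreal (a k) * (\<Sum>j\<in>S \<inter> {..k}. indicator (R j \<inter> R k) x)) \<partial>M)"
      proof (intro nn_integral_cong)
        fix x
        have "ennreal (H x) = (\<Sum>k\<in>S. ennreal (a k * (\<Sum>j\<in>S \<inter> {..k}. indicator (R j \<inter> R k) x)))"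
          unfolding H_def using a0
          by (subst sum_ennreal; auto intro!: sum_nonneg mult_nonneg_nonneg sum.cong arg_cong[where f=ennreal]
              simp: sum_distrib_left indicator_inter_arith mult_ac simp del: sum_ennreal)
        also have "\<dots> = (\<Sum>k\<in>S. ennreal (a k) * (\<Sum>j\<in>S \<inter> {..k}. indicator (R j \<inter> R k) x))"
          using a0 by (intro sum.cong refl) (simp add: ennreal_mult sum_nonneg ennreal_indicator flip: sum_ennreal)
        finally show "ennreal (H x) = (\<Sum>k\<in>S. ennreal (a k) * (\<Sum>j\<in>S \<inter> {..k}. indicator (R j \<inter> R k) x))" .
      qed
      also have "\<dots> = (\<Sum>k\<in>S. ennreal (a k) * (\<Sum>j\<in>S \<inter> {..k}. emeasure M (R j \<inter> R k)))"
      proof (subst nn_integral_sum)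
        show "(\<lambda>x. ennreal (a k) * (\<Sum>j\<in>S \<inter> {..k}. indicator (R j \<inter> R k) x)) \<in> borel_measurable M"
          if "k \<in> S" for k using that by measurable
        show "(\<Sum>k\<in>S. \<integral>\<^sup>+x. ennreal (a k) * (\<Sum>j\<in>S \<inter> {..k}. indicator (R j \<inter> R k) x) \<partial>M)
          = (\<Sum>k\<in>S. ennreal (a k) * (\<Sum>j\<in>S \<inter> {..k}. emeasure M (R j \<inter> R k)))"
        proof (intro sum.cong refl)
          fix k assume k: "k \<in> S"
          then show "(\<integral>\<^sup>+x. ennreal (a k) * (\<Sum>j\<in>S \<inter> {..k}. indicator (R j \<inter> R k) x) \<partial>M)
            = ennreal (a k) * (\<Sum>j\<in>S \<inter> {..k}. emeasure M (R j \<inter> R k))"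
            by (subst nn_integral_cmult, measurable) (subst nn_integral_sum, auto)
        qed
      qed
      also have "\<dots> = (\<Sum>k\<in>S. ennreal (a k * (\<Sum>j\<in>S \<inter> {..k}. measure M (R j \<inter> R k))))"
      proof (intro sum.cong refl)
        fix k assume k: "k \<in> S"
        have "(\<Sum>j\<in>S \<inter> {..k}. emeasure M (R j \<inter> R k)) = ennreal (\<Sum>j\<in>S \<inter> {..k}. measure M (R j \<inter> R k))"
          by (subst sum_ennreal[symmetric], simp)
            (rule sum.cong[OF refl], rule emeasure_eq_measure2, use R k in auto)
        then show "ennreal (a k) * (\<Sum>j\<in>S \<inter> {..k}. emeasure M (R j \<inter> R k))
            = ennreal (a k * (\<Sum>j\<in>S \<inter> {..k}. measure M (R j \<inter> R k)))"
          using a0 by (simp add: ennreal_mult sum_nonneg)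
      qed
      also have "\<dots> \<le> (\<Sum>k\<in>S. ennreal (a k * (T * measure M (R k))))"
        using a0 sparse by (intro sum_mono ennreal_leI mult_left_mono) auto
      also have "\<dots> = ennreal (\<Sum>k\<in>S. a k * (T * measure M (R k)))"
        using a0 T by (intro sum_ennreal) auto
      also have "(\<Sum>k\<in>S. a k * (T * measure M (R k))) = T * X"
        unfolding X_def by (simp add: sum_distrib_left mult_ac)
      finally show ?thesis .
    qed
    obtain y where y: "J = ennreal y" "0 \<le> y" using J by (cases J) auto
    have [measurable]: "H \<in> borel_measurable M" unfolding H_def by measurable
    have "ennreal (L * X) = (\<Sum>j\<in>S. ennreal (a j) * ennreal (L * measure M (R j)))"
      using a0 L unfolding X_def by (simp add: sum_distrib_left ennreal_mult[symmetric] mult_ac)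
    also have "\<dots> \<le> (\<Sum>j\<in>S. ennreal (a j) * (\<integral>\<^sup>+x\<in>R j. g x \<partial>M))"
      by (intro sum_mono mult_left_mono avg) auto
    also have "\<dots> = (\<integral>\<^sup>+x. (\<Sum>j\<in>S. ennreal (a j) * (g x * indicator (R j) x)) \<partial>M)"
    proof (subst nn_integral_sum)
      show "(\<lambda>x. ennreal (a j) * (g x * indicator (R j) x)) \<in> borel_measurable M" if "j \<in> S" for j
        using that by measurable
      show "(\<Sum>j\<in>S. ennreal (a j) * (\<integral>\<^sup>+x\<in>R j. g x \<partial>M))
        = (\<Sum>j\<in>S. \<integral>\<^sup>+x. ennreal (a j) * (g x * indicator (R j) x) \<partial>M)"
        by (intro sum.cong refl nn_integral_cmult[symmetric]) measurable
    qed
    also have "\<dots> \<le> (\<integral>\<^sup>+x. ennreal \<epsilon> * ((g x)\<^sup>2 * W x) + ennreal (1 / (2 * \<epsilon>)) * ennreal (H x) \<partial>M)"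
      by (intro nn_integral_mono pt)
    also have "\<dots> = ennreal \<epsilon> * J + ennreal (1 / (2 * \<epsilon>)) * (\<integral>\<^sup>+x. ennreal (H x) \<partial>M)"
      unfolding J_def
      by (subst nn_integral_add, measurable) (intro arg_cong2[where f="(+)"] nn_integral_cmult; measurable)
    also have "\<dots> \<le> ennreal \<epsilon> * J + ennreal (1 / (2 * \<epsilon>)) * ennreal (T * X)"
      by (intro add_left_mono mult_left_mono IH) auto
    also have "\<dots> = ennreal (\<epsilon> * y + 1 / (2 * \<epsilon>) * (T * X))"
      using ennreal_comb[of "1 / (2 * \<epsilon>)" y "T * X"] y e0 T X0 by simp
    finally have "L * X \<le> \<epsilon> * y + 1 / (2 * \<epsilon>) * (T * X)"
      using y e0 T X0 by (subst (asm) ennreal_le_iff) auto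
    also have "\<dots> = T / L * y + L * X / 2" using T0 L by (simp add: \<epsilon>_def)
    finally have "L * X \<le> 2 * (T / L * y)" by simp
    then have "L * (L * X) \<le> L * (2 * (T / L * y))" using L by (intro mult_left_mono) auto
    then have "L\<^sup>2 * X \<le> 2 * T * y" using L by (simp add: power2_eq_square mult.assoc)
    then have "ennreal (L\<^sup>2 * X) \<le> ennreal (2 * T * y)" by (rule ennreal_leI)
    then show ?thesis unfolding X J_def[symmetric] y using T X0 y by (simp add: ennreal_mult)
  qed
qed

section \<open>The weak type (2,2) bound\<close>

lemma ennreal_divide_mult_cancel:
  assumes "0 < V"
  shows "I / ennreal V * ennreal V = I"
  using assms by (simp add: ennreal_divide_times ennreal_divide_self)

text \<open>The constant is \<open>32400 * 9 * 2\<close>: the first factor comes from the covering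
  argument, the second is the area ratio of a threefold dilate, the third belongs to the duality
  argument.\<close>

lemma finite_weak_type_sorted:
  fixes \<sigma> c :: "nat \<Rightarrow> real^2" and A B :: "nat \<Rightarrow> real" and g w :: "real^2 \<Rightarrow> ennreal" and L :: real
  assumes N: "N > 0"
    and [measurable]: "g \<in> borel_measurable lebesgue" "w \<in> borel_measurable lebesgue"
    and fin: "\<And>x. g x < \<infinity>" and L: "0 < L"
    and R: "\<And>i. i < n \<Longrightarrow> \<sigma> i \<in> uniform_directions N \<and> 0 < B i \<and> B i \<le> A i"
    and dec: "\<And>i j. i \<le> j \<Longrightarrow> j < n \<Longrightarrow> A j \<le> A i"
    and avg: "\<And>i. i < n \<Longrightarrow> ennreal L < (\<integral>\<^sup>+y\<in>orect (\<sigma> i) (c i) (A i) (B i). g y \<partial>lebesgue)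
        / emeasure lebesgue (orect (\<sigma> i) (c i) (A i) (B i))"
  shows "ennreal (L\<^sup>2) * (\<integral>\<^sup>+x\<in>(\<Union>i<n. orect (\<sigma> i) (c i) (A i) (B i)). w x \<partial>lebesgue)
    \<le> ennreal (583200 * (real (scale_count N) + 1)) *
      (\<integral>\<^sup>+x. (g x)\<^sup>2 * directional_maximal (uniform_directions N) (hl_maximal w) x \<partial>lebesgue)"
proof -
  define r where "r i = orect (\<sigma> i) (c i) (A i) (B i)" for i
  define r' where "r' i = orect (\<sigma> i) (c i) (3 * A i) (3 * B i)" for i
  define T where "T = real (scale_count N)"
  define h where "h = hl_maximal w"
  define W where "W = directional_maximal (uniform_directions N) h"
  obtain S where S: "S \<subseteq> {..<n}"
    "\<And>k. k < n \<Longrightarrow> k \<in> S \<longleftrightarrow> (\<Sum>j\<in>S \<inter> {..<k}. measure lebesgue (r j \<inter> r k)) \<le> T * measure lebesgue (r k)"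
    using exists_greedy_selection[of n "\<lambda>j k. measure lebesgue (r j \<inter> r k)" "\<lambda>k. T * measure lebesgue (r k)"] by blast
  have fS: "finite S" using S(1) finite_subset by blast
  have unit: "norm (\<sigma> i) = 1" if "i < n" for i using R[OF that] norm_uniform_directions by blast
  have lm: "r i \<in> lmeasurable" "r' i \<in> lmeasurable" if "i < n" for i
    using R[OF that] unit[OF that] by (auto simp: r_def r'_def intro!: orect_lmeasurable)
  have sub: "r i \<subseteq> r' i" if "i < n" for i
    using R[OF that] by (auto simp: r_def r'_def orect_def)
  have er: "emeasure lebesgue (r i) = ennreal (4 * A i * B i)" "measure lebesgue (r i) = 4 * A i * B i"
    "emeasure lebesgue (r' i) = ennreal (9 * (4 * A i * B i))" if "i < n" for i
    using R[OF that] unit[OF that] by (auto simp: r_def r'_def emeasure_orect measure_orect)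
  have pos: "0 < 4 * A i * B i" if "i < n" for i using R[OF that] by simp
  have [measurable]: "r i \<in> sets lebesgue" "r' i \<in> sets lebesgue" if "i \<in> S" for i
    using lm[of i] that S(1) by auto
  have [measurable]: "h \<in> borel_measurable lebesgue" by (simp add: h_def)
  have [measurable]: "W \<in> borel_measurable lebesgue"
    unfolding W_def by (intro directional_maximal_measurable norm_uniform_directions)
  define F :: "real^2 \<Rightarrow> ennreal" where "F x = (\<Sum>j\<in>S. indicator (r' j) x)" for x
  have [measurable]: "F \<in> borel_measurable lebesgue" unfolding F_def by measurable
  have mass: "\<exists>\<rho>. 0 < \<rho> \<and> \<rho> \<le> A k \<and> \<rho>\<^sup>2 / 4 \<le> (\<Sum>j\<in>S. measure lebesgue (r' j \<inter> ball x (9 * \<rho>)))"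
    if k: "k < n" "x \<in> r k" for k x
  proof (cases "k \<in> S")
    case True
    have "(B k)\<^sup>2 / 4 \<le> measure lebesgue (r' k \<inter> ball x (9 * B k))"
      unfolding r'_def using R[OF k(1)] k unit[OF k(1)] by (intro exists_mass_near_self) (auto simp: r_def)
    also have "\<dots> \<le> (\<Sum>j\<in>S. measure lebesgue (r' j \<inter> ball x (9 * B k)))"
      using True fS by (intro member_le_sum[of k S "\<lambda>j. measure lebesgue (r' j \<inter> ball x (9 * B k))"]) auto
    finally show ?thesis using R[OF k(1)] by blast
  next
    case False
    then have big: "T * measure lebesgue (r k) \<le> (\<Sum>j\<in>S \<inter> {..<k}. measure lebesgue (r j \<inter> r k))"
      using S(2)[OF k(1)] by simp
    have "\<exists>\<rho>. 0 < \<rho> \<and> \<rho> \<le> A k \<and>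
      \<rho>\<^sup>2 / 4 \<le> (\<Sum>j\<in>S \<inter> {..<k}. measure lebesgue (orect (\<sigma> j) (c j) (3 * A j) (3 * B j) \<inter> ball x (9 * \<rho>)))"
    proof (rule exists_scale_large_mass[OF N])
      show "real (scale_count N) * measure lebesgue (orect (\<sigma> k) (c k) (A k) (B k))
        \<le> (\<Sum>j\<in>S \<inter> {..<k}. measure lebesgue (orect (\<sigma> j) (c j) (A j) (B j) \<inter> orect (\<sigma> k) (c k) (A k) (B k)))"
        using big by (simp add: r_def T_def)
    qed (use fS R dec k in \<open>auto simp: r_def\<close>)
    then obtain \<rho> where \<rho>: "0 < \<rho>" "\<rho> \<le> A k"
      "\<rho>\<^sup>2 / 4 \<le> (\<Sum>j\<in>S \<inter> {..<k}. measure lebesgue (r' j \<inter> ball x (9 * \<rho>)))"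
      unfolding r'_def by blast
    have "(\<Sum>j\<in>S \<inter> {..<k}. measure lebesgue (r' j \<inter> ball x (9 * \<rho>)))
        \<le> (\<Sum>j\<in>S. measure lebesgue (r' j \<inter> ball x (9 * \<rho>)))"
      using fS by (intro sum_mono2) auto
    then show ?thesis using \<rho> by (intro exI[of _ \<rho>]) linarith
  qed
  \<comment> \<open>The number \<open>c = 1 / 32400\<close> solves
    \<open>100 * c * (9 * \<rho>)\<^sup>2 = \<rho>\<^sup>2 / 4\<close>.\<close>
  have 1: "ennreal (1 / 32400) * (\<integral>\<^sup>+x\<in>(\<Union>i<n. r i). w x \<partial>lebesgue) \<le> (\<integral>\<^sup>+x. F x * h x \<partial>lebesgue)"
    unfolding h_def
  \<comment> \<open>Scales are at most \<open>A k\<close>, and \<open>A 0\<close> is the largest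
    half length, so all radii \<open>9 * \<rho>\<close> are bounded.\<close>
  proof (rule nn_integral_le_maximal_dual[where K = "9 * A 0"])
    fix x assume "x \<in> (\<Union>i<n. r i)"
    then obtain k where k: "k < n" "x \<in> r k" by blast
    obtain \<rho> where \<rho>: "0 < \<rho>" "\<rho> \<le> A k" "\<rho>\<^sup>2 / 4 \<le> (\<Sum>j\<in>S. measure lebesgue (r' j \<inter> ball x (9 * \<rho>)))"
      using mass[OF k] by blast
    have "ennreal (100 * (1 / 32400) * (9 * \<rho>)\<^sup>2) = ennreal (\<rho>\<^sup>2 / 4)" by (simp add: power_mult_distrib)
    also have "\<dots> \<le> ennreal (\<Sum>j\<in>S. measure lebesgue (r' j \<inter> ball x (9 * \<rho>)))" using \<rho>(3) by (rule ennreal_leI)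
    also have "\<dots> = (\<Sum>j\<in>S. ennreal (measure lebesgue (r' j \<inter> ball x (9 * \<rho>))))" by simp
    also have "\<dots> = (\<Sum>j\<in>S. emeasure lebesgue (r' j \<inter> ball x (9 * \<rho>)))"
    proof (intro sum.cong refl emeasure_eq_measure2[symmetric])
      fix j assume "j \<in> S"
      then show "r' j \<inter> ball x (9 * \<rho>) \<in> lmeasurable" using lm(2)[of j] S(1) by (intro fmeasurable.Int) auto
    qed
    also have "\<dots> = (\<Sum>j\<in>S. \<integral>\<^sup>+y. indicator (r' j) y * indicator (ball x (9 * \<rho>)) y \<partial>lebesgue)"
      unfolding indicator_inter_arith[symmetric]
      by (intro sum.cong refl nn_integral_indicator[symmetric]) auto
    also have "\<dots> = (\<integral>\<^sup>+y. (\<Sum>j\<in>S. indicator (r' j) y * indicator (ball x (9 * \<rho>)) y) \<partial>lebesgue)"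
    proof (rule nn_integral_sum[symmetric])
      fix j assume "j \<in> S"
      then have "r' j \<inter> ball x (9 * \<rho>) \<in> sets lebesgue" by auto
      then show "(\<lambda>y. indicator (r' j) y * indicator (ball x (9 * \<rho>)) y :: ennreal) \<in> borel_measurable lebesgue"
        unfolding indicator_inter_arith[symmetric] by simp
    qed
    also have "\<dots> = (\<integral>\<^sup>+y\<in>ball x (9 * \<rho>). F y \<partial>lebesgue)"
      by (intro nn_integral_cong) (simp add: F_def sum_distrib_right)
    finally show "\<exists>\<rho>>0. \<rho> \<le> 9 * A 0 \<and> ennreal (100 * (1 / 32400) * \<rho>\<^sup>2) \<le> (\<integral>\<^sup>+y\<in>ball x \<rho>. F y \<partial>lebesgue)"
      using \<rho> dec[of 0 k] k by (intro exI[of _ "9 * \<rho>"]) auto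
  qed simp_all
  define v where "v j = (\<integral>\<^sup>+y\<in>r' j. h y \<partial>lebesgue) / emeasure lebesgue (r' j)" for j
  have "(\<integral>\<^sup>+x. F x * h x \<partial>lebesgue) = (\<integral>\<^sup>+x. (\<Sum>j\<in>S. h x * indicator (r' j) x) \<partial>lebesgue)"
    by (intro nn_integral_cong) (simp add: F_def sum_distrib_left mult.commute)
  also have "\<dots> = (\<Sum>j\<in>S. \<integral>\<^sup>+x\<in>r' j. h x \<partial>lebesgue)"
    by (rule nn_integral_sum) measurable
  also have "\<dots> = (\<Sum>j\<in>S. ennreal 9 * (v j * emeasure lebesgue (r j)))"
  proof (intro sum.cong refl)
    fix j assume "j \<in> S"
    then have j: "j < n" using S(1) by auto
    have "ennreal 9 * (v j * emeasure lebesgue (r j)) = v j * emeasure lebesgue (r' j)"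
      unfolding er(1,3)[OF j] by (subst ennreal_mult) (use pos[OF j] in \<open>auto simp: mult_ac\<close>)
    also have "\<dots> = (\<integral>\<^sup>+x\<in>r' j. h x \<partial>lebesgue)"
      unfolding v_def er(3)[OF j] by (rule ennreal_divide_mult_cancel) (use pos[OF j] in simp)
    finally show "(\<integral>\<^sup>+x\<in>r' j. h x \<partial>lebesgue) = ennreal 9 * (v j * emeasure lebesgue (r j))" by simp
  qed
  also have "\<dots> = ennreal 9 * (\<Sum>j\<in>S. v j * emeasure lebesgue (r j))" by (simp add: sum_distrib_left)
  finally have 2: "(\<integral>\<^sup>+x. F x * h x \<partial>lebesgue) = ennreal 9 * (\<Sum>j\<in>S. v j * emeasure lebesgue (r j))" .
  have 3: "ennreal (L\<^sup>2) * (\<Sum>j\<in>S. v j * emeasure lebesgue (r j))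
      \<le> ennreal (2 * (T + 1)) * (\<integral>\<^sup>+x. (g x)\<^sup>2 * W x \<partial>lebesgue)"
  proof (rule sparse_weighted_sum_le[OF fS])
    fix j assume "j \<in> S"
    then have j: "j < n" using S(1) by auto
    show "r j \<in> lmeasurable" by (rule lm[OF j])
    show "0 < measure lebesgue (r j)" using pos[OF j] er[OF j] by simp
    show "v j \<le> W x" if "x \<in> r j" for x
      unfolding v_def W_def directional_maximal_def
    proof (rule maximal_operator_ge)
      show "x \<in> r' j" using that sub[OF j] by blast
      have dr: "directional_rectangles (uniform_directions N)
          = {orect \<sigma> c A B | \<sigma> c A B. \<sigma> \<in> uniform_directions N \<and> 0 < B \<and> B \<le> A}"
        by (rule directional_rectangles_eq) (rule norm_uniform_directions)
      show "r' j \<in> directional_rectangles (uniform_directions N)"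
        unfolding dr r'_def mem_Collect_eq using R[OF j]
        by (intro exI[of _ "\<sigma> j"] exI[of _ "c j"] exI[of _ "3 * A j"] exI[of _ "3 * B j"]) auto
    qed
    have "ennreal L < (\<integral>\<^sup>+y\<in>r j. g y \<partial>lebesgue) / ennreal (4 * A j * B j)"
      using avg[OF j] er(1)[OF j] unfolding r_def by simp
    then have "ennreal L * ennreal (4 * A j * B j)
        \<le> (\<integral>\<^sup>+y\<in>r j. g y \<partial>lebesgue) / ennreal (4 * A j * B j) * ennreal (4 * A j * B j)"
      by (intro mult_right_mono) auto
    also have "\<dots> = (\<integral>\<^sup>+y\<in>r j. g y \<partial>lebesgue)"
      by (rule ennreal_divide_mult_cancel[OF pos[OF j]])
    finally show "ennreal (L * measure lebesgue (r j)) \<le> (\<integral>\<^sup>+x\<in>r j. g x \<partial>lebesgue)"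
      using L pos[OF j] er(2)[OF j] by (simp add: ennreal_mult)
    \<comment> \<open>The selection rule concerns strict predecessors; the overlap of
      \<open>r j\<close> with itself raises \<open>T\<close> to \<open>T + 1\<close>.\<close>
    have "S \<inter> {..j} = insert j (S \<inter> {..<j})" using \<open>j \<in> S\<close> by auto
    then have "(\<Sum>i\<in>S \<inter> {..j}. measure lebesgue (r i \<inter> r j))
        = measure lebesgue (r j) + (\<Sum>i\<in>S \<inter> {..<j}. measure lebesgue (r i \<inter> r j))"
      using fS by simp
    also have "\<dots> \<le> (T + 1) * measure lebesgue (r j)"
      using S(2)[OF j] \<open>j \<in> S\<close> by (simp add: algebra_simps)
    finally show "(\<Sum>i\<in>S \<inter> {..j}. measure lebesgue (r i \<inter> r j)) \<le> (T + 1) * measure lebesgue (r j)" .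
  qed (use fin L in \<open>auto simp: T_def\<close>)
  define I where "I = (\<integral>\<^sup>+x\<in>(\<Union>i<n. r i). w x \<partial>lebesgue)"
  have "ennreal 32400 * ennreal (1 / 32400) = 1" by (subst ennreal_mult[symmetric]) auto
  then have "ennreal (L\<^sup>2) * I = (ennreal 32400 * ennreal (1 / 32400)) * (ennreal (L\<^sup>2) * I)" by simp
  also have "\<dots> = ennreal 32400 * (ennreal (L\<^sup>2) * (ennreal (1 / 32400) * I))" by (simp only: mult_ac)
  also have "\<dots> \<le> ennreal 32400 * (ennreal (L\<^sup>2) * (ennreal 9 * (\<Sum>j\<in>S. v j * emeasure lebesgue (r j))))"
    using 1 2 by (intro mult_left_mono) (auto simp: I_def)
  also have "\<dots> = ennreal (32400 * 9) * (ennreal (L\<^sup>2) * (\<Sum>j\<in>S. v j * emeasure lebesgue (r j)))"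
    by (subst ennreal_mult) (simp_all add: mult_ac del: ennreal_numeral)
  also have "\<dots> \<le> ennreal (32400 * 9) * (ennreal (2 * (T + 1)) * (\<integral>\<^sup>+x. (g x)\<^sup>2 * W x \<partial>lebesgue))"
    by (intro mult_left_mono 3) simp
  also have "\<dots> = ennreal (583200 * (T + 1)) * (\<integral>\<^sup>+x. (g x)\<^sup>2 * W x \<partial>lebesgue)"
    unfolding mult.assoc[symmetric] by (subst ennreal_mult[symmetric]) (auto simp: T_def)
  finally show ?thesis unfolding I_def r_def T_def W_def h_def .
qed

text \<open>Neither the union nor the assumptions on the single rectangles depend on the
  enumeration, so the list may be sorted by decreasing length.\<close>

lemma finite_weak_type:
  fixes \<sigma> c :: "nat \<Rightarrow> real^2" and A B :: "nat \<Rightarrow> real" and g w :: "real^2 \<Rightarrow> ennreal" and L :: real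
  assumes N: "N > 0"
    and meas: "g \<in> borel_measurable lebesgue" "w \<in> borel_measurable lebesgue"
    and fin: "\<And>x. g x < \<infinity>" and L: "0 < L"
    and R: "\<And>i. i < n \<Longrightarrow> \<sigma> i \<in> uniform_directions N \<and> 0 < B i \<and> B i \<le> A i"
    and avg: "\<And>i. i < n \<Longrightarrow> ennreal L < (\<integral>\<^sup>+y\<in>orect (\<sigma> i) (c i) (A i) (B i). g y \<partial>lebesgue)
        / emeasure lebesgue (orect (\<sigma> i) (c i) (A i) (B i))"
  shows "ennreal (L\<^sup>2) * (\<integral>\<^sup>+x\<in>(\<Union>i<n. orect (\<sigma> i) (c i) (A i) (B i)). w x \<partial>lebesgue)
    \<le> ennreal (583200 * (real (scale_count N) + 1)) *
      (\<integral>\<^sup>+x. (g x)\<^sup>2 * directional_maximal (uniform_directions N) (hl_maximal w) x \<partial>lebesgue)"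
proof -
  define p where "p = sort_key (\<lambda>i. - A i) [0..<n]"
  have p: "length p = n" "set p = {..<n}" by (auto simp: p_def)
  then have pn: "p ! i < n" if "i < n" for i using that nth_mem[of i p] by auto
  have srt: "sorted (map (\<lambda>i. - A i) p)" by (simp add: p_def)
  have dec: "A (p ! j) \<le> A (p ! i)" if "i \<le> j" "j < n" for i j
    using sorted_nth_mono[OF srt that(1)] that p by simp
  have "(\<lambda>i. p ! i) ` {..<n} = {..<n}"
    using p by (metis atLeast0LessThan map_nth set_map set_upt)
  then have un: "(\<Union>i<n. orect (\<sigma> (p ! i)) (c (p ! i)) (A (p ! i)) (B (p ! i)))
      = (\<Union>i<n. orect (\<sigma> i) (c i) (A i) (B i))"
    using image_image[of "\<lambda>i. orect (\<sigma> i) (c i) (A i) (B i)" "\<lambda>i. p ! i" "{..<n}"] by metis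
  show ?thesis
    unfolding un[symmetric]
    by (rule finite_weak_type_sorted[OF N meas fin L]) (use R avg pn dec in blast)+
qed

text \<open>The superlevel set is covered by interiors of rectangles with large mean. Lindelof's
  theorem leaves countably many of them, and the bound for finite subfamilies does not depend on
  their number, so it passes to the limit by monotone convergence.\<close>

lemma directional_maximal_weak_type:
  fixes g w :: "real^2 \<Rightarrow> ennreal" and L :: real
  assumes N: "N > 0"
    and [measurable]: "g \<in> borel_measurable lebesgue" "w \<in> borel_measurable lebesgue"
    and fin: "\<And>x. g x < \<infinity>" and L: "0 < L"
  shows "ennreal (L\<^sup>2) * (\<integral>\<^sup>+x\<in>{x. ennreal L < directional_maximal (uniform_directions N) g x}. w x \<partial>lebesgue)
    \<le> ennreal (583200 * (real (scale_count N) + 1)) *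
      (\<integral>\<^sup>+x. (g x)\<^sup>2 * directional_maximal (uniform_directions N) (hl_maximal w) x \<partial>lebesgue)" (is "_ * ?I \<le> ?rhs")
proof -
  define \<B> where "\<B> = directional_rectangles (uniform_directions N)"
  have \<B>: "\<B> = {orect \<sigma> c A B | \<sigma> c A B. \<sigma> \<in> uniform_directions N \<and> 0 < B \<and> B \<le> A}"
    unfolding \<B>_def by (rule directional_rectangles_eq) (rule norm_uniform_directions)
  have dc: "dilation_closed \<B>"
    unfolding \<B>_def by (rule dilation_closed_directional) (rule norm_uniform_directions)
  define E where "E = {x. ennreal L < directional_maximal (uniform_directions N) g x}"
  define G where "G = {R \<in> \<B>. ennreal L < (\<integral>\<^sup>+y\<in>R. g y \<partial>lebesgue) / emeasure lebesgue R}"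
  have E: "E \<subseteq> (\<Union>R\<in>G. interior R)"
  proof
    fix x assume "x \<in> E"
    then have "ennreal L < maximal_operator \<B> g x" by (simp add: E_def directional_maximal_def \<B>_def)
    from less_maximal_operator_interior[OF dc this] obtain R where "R \<in> \<B>" "x \<in> interior R"
      "ennreal L < (\<integral>\<^sup>+y\<in>R. g y \<partial>lebesgue) / emeasure lebesgue R" .
    then show "x \<in> (\<Union>R\<in>G. interior R)" by (auto simp: G_def)
  qed
  obtain D where D: "D \<subseteq> interior ` G" "countable D" "\<Union>D = (\<Union>R\<in>G. interior R)"
    using Lindelof[of "interior ` G"] by auto
  show ?thesis
  proof (cases "D = {}")
    case True
    then have "E = {}" using E D(3) by auto
    then show ?thesis unfolding E_def[symmetric] by simp
  next
    case False
    have "\<exists>R. R \<in> G \<and> from_nat_into D i = interior R" for i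
      using from_nat_into[OF False, of i] D(1) by blast
    then obtain r where r: "\<And>i. r i \<in> G" "\<And>i. from_nat_into D i = interior (r i)" by metis
    have "\<exists>\<sigma> c A B. r i = orect \<sigma> c A B \<and> \<sigma> \<in> uniform_directions N \<and> 0 < B \<and> B \<le> A" for i
      using r(1)[of i] unfolding G_def \<B> by blast
    then obtain \<sigma> c A B where R: "\<And>i. r i = orect (\<sigma> i) (c i) (A i) (B i)"
      "\<And>i. \<sigma> i \<in> uniform_directions N \<and> 0 < B i \<and> B i \<le> A i" by metis
    have avg: "ennreal L < (\<integral>\<^sup>+y\<in>r i. g y \<partial>lebesgue) / emeasure lebesgue (r i)" for i
      using r(1)[of i] by (simp add: G_def)
    have [measurable]: "r i \<in> sets lebesgue" for i
      unfolding R(1) using R(2)[of i] norm_uniform_directions[of "\<sigma> i" N]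
      by (intro fmeasurableD orect_lmeasurable) auto
    have "E \<subseteq> \<Union> (range (from_nat_into D))" using E D False by simp
    also have "\<dots> \<subseteq> (\<Union>n. \<Union>i<n. r i)"
    proof
      fix x assume "x \<in> \<Union> (range (from_nat_into D))"
      then obtain i where "x \<in> interior (r i)" using r(2) by auto
      then have "x \<in> (\<Union>j<Suc i. r j)" using interior_subset[of "r i"] by blast
      then show "x \<in> (\<Union>n. \<Union>i<n. r i)" by blast
    qed
    finally have "E \<subseteq> (\<Union>n. \<Union>i<n. r i)" .
    then have "(\<integral>\<^sup>+x\<in>E. w x \<partial>lebesgue) \<le> (\<integral>\<^sup>+x. (SUP n. w x * indicator (\<Union>i<n. r i) x) \<partial>lebesgue)"
    proof (intro nn_integral_mono)
      fix x assume E: "E \<subseteq> (\<Union>n. \<Union>i<n. r i)"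
      show "w x * indicator E x \<le> (SUP n. w x * indicator (\<Union>i<n. r i) x)"
      proof (cases "x \<in> E")
        case True
        then obtain n where "x \<in> (\<Union>i<n. r i)" using E by blast
        then show ?thesis using True by (intro SUP_upper2[of n]) auto
      qed simp
    qed
    also have "\<dots> = (SUP n. \<integral>\<^sup>+x\<in>(\<Union>i<n. r i). w x \<partial>lebesgue)"
    proof (rule nn_integral_monotone_convergence_SUP)
      show "incseq (\<lambda>n x. w x * indicator (\<Union>i<n. r i) x)"
      proof (intro monoI le_funI mult_left_mono)
        fix m n :: nat and x assume "m \<le> n"
        then have "(\<Union>i<m. r i) \<subseteq> (\<Union>i<n. r i)" by fastforce
        then show "indicator (\<Union>i<m. r i) x \<le> (indicator (\<Union>i<n. r i) x :: ennreal)"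
          by (auto split: split_indicator)
      qed simp
    qed measurable
    finally have "ennreal (L\<^sup>2) * (\<integral>\<^sup>+x\<in>E. w x \<partial>lebesgue)
        \<le> ennreal (L\<^sup>2) * (SUP n. \<integral>\<^sup>+x\<in>(\<Union>i<n. r i). w x \<partial>lebesgue)" by (intro mult_left_mono) auto
    also have "\<dots> = (SUP n. ennreal (L\<^sup>2) * (\<integral>\<^sup>+x\<in>(\<Union>i<n. r i). w x \<partial>lebesgue))"
      by (rule SUP_mult_left_ennreal)
    also have "\<dots> \<le> ?rhs"
    proof (rule SUP_least)
      fix n
      show "ennreal (L\<^sup>2) * (\<integral>\<^sup>+x\<in>(\<Union>i<n. r i). w x \<partial>lebesgue) \<le> ?rhs"
        unfolding R(1) by (rule finite_weak_type[OF N assms(2,3) fin L R(2)]) (rule avg[unfolded R(1)])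
    qed
    finally show ?thesis by (simp add: E_def)
  qed
qed

section \<open>Layer cake formula and the strong type bound\<close>

lemma nn_integral_powr_from_0:
  fixes q c :: real
  assumes q: "0 < q" and c: "0 \<le> c"
  shows "(\<integral>\<^sup>+l. ennreal (q * l powr (q - 1)) * indicator {0<..<c} l \<partial>lborel) = ennreal (c powr q)"
proof -
  have "((\<lambda>l. l powr (q - 1)) has_integral (c powr q / q)) {0..c}"
    using has_integral_powr_from_0[of "q - 1" c] q c by simp
  then have "((\<lambda>l. q * l powr (q - 1)) has_integral (q * (c powr q / q))) {0..c}"
    by (rule has_integral_mult_right)
  then have "((\<lambda>l. q * l powr (q - 1)) has_integral (c powr q)) {0<..<c}"
    using q has_integral_Icc_iff_Ioo by fastforce
  from nn_integral_has_integral_lebesgue[OF _ this]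
  have "(\<integral>\<^sup>+l. ennreal (indicator {0<..<c} l * (q * l powr (q - 1))) \<partial>lborel) = ennreal (c powr q)"
    using q by simp
  moreover have "ennreal (indicator {0<..<c} l * (q * l powr (q - 1)))
      = ennreal (q * l powr (q - 1)) * indicator {0<..<c} l" for l
    by (simp split: split_indicator)
  ultimately show ?thesis by simp
qed

text \<open>Fubini's theorem for the layer cake integral requires this of the completed
  measure.\<close>

lemma sigma_finite_lebesgue: "sigma_finite_measure (lebesgue :: 'a::euclidean_space measure)"
proof
  define A where "A = range (\<lambda>n::nat. cball (0::'a) (real n))"
  have "\<Union>A = space lebesgue" using real_arch_simple by (auto simp: A_def)
  moreover have "countable A" "A \<subseteq> sets lebesgue" by (auto simp: A_def)
  moreover have "\<forall>a\<in>A. emeasure lebesgue a \<noteq> \<infinity>"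
  proof
    fix a assume "a \<in> A"
    then have "a \<in> lmeasurable" by (auto simp: A_def)
    then show "emeasure lebesgue a \<noteq> \<infinity>" by (auto simp: fmeasurable_def)
  qed
  ultimately show "\<exists>A::'a set set. countable A \<and> A \<subseteq> sets lebesgue \<and> \<Union>A = space lebesgue
      \<and> (\<forall>a\<in>A. emeasure lebesgue a \<noteq> \<infinity>)" by blast
qed

text \<open>Values of at most \<open>l / 2\<close> contribute at most \<open>l / 2\<close> to any
  mean, so the same rectangle is a witness for the truncated function at half the level.\<close>

lemma maximal_operator_split_level:
  assumes \<B>: "dilation_closed \<B>" and l: "0 < l" and [measurable]: "g \<in> borel_measurable lebesgue"
    and gt: "ennreal l < maximal_operator \<B> g x"
  shows "ennreal (l / 2) < maximal_operator \<B> (\<lambda>y. g y * indicator {y. ennreal (l / 2) < g y} y) x"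
proof -
  define h where "h y = g y * indicator {y. ennreal (l / 2) < g y} y" for y
  have [measurable]: "h \<in> borel_measurable lebesgue" unfolding h_def by measurable
  obtain R where R: "R \<in> \<B>" "x \<in> R" "ennreal l < (\<integral>\<^sup>+y\<in>R. g y \<partial>lebesgue) / emeasure lebesgue R"
    using gt unfolding less_maximal_operator_iff by blast
  then obtain e c A B where e: "R = orect e c A B" "norm e = 1" "0 < A" "0 < B"
    using \<B> unfolding dilation_closed_def by metis
  define V where "V = 4 * A * B"
  have V: "0 < V" "emeasure lebesgue R = ennreal V" using e by (simp_all add: V_def emeasure_orect)
  have [measurable]: "R \<in> sets lebesgue" unfolding e(1) using e by (intro fmeasurableD orect_lmeasurable) auto
  have "(\<integral>\<^sup>+y\<in>R. g y \<partial>lebesgue) \<le> (\<integral>\<^sup>+y. h y * indicator R y + ennreal (l / 2) * indicator R y \<partial>lebesgue)"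
    by (intro nn_integral_mono) (auto simp: h_def split: split_indicator)
  also have "\<dots> = (\<integral>\<^sup>+y\<in>R. h y \<partial>lebesgue) + ennreal (l / 2) * ennreal V"
    by (subst nn_integral_add) (auto simp: nn_integral_cmult_indicator V)
  finally have "(\<integral>\<^sup>+y\<in>R. g y \<partial>lebesgue) / ennreal V
      \<le> ((\<integral>\<^sup>+y\<in>R. h y \<partial>lebesgue) + ennreal (l / 2) * ennreal V) / ennreal V"
    by (rule divide_right_mono_ennreal)
  also have "\<dots> = (\<integral>\<^sup>+y\<in>R. h y \<partial>lebesgue) / ennreal V + ennreal (l / 2)"
    using V by (simp add: add_divide_distrib_ennreal ennreal_mult_divide_eq)
  finally have "ennreal (l / 2) + ennreal (l / 2) < (\<integral>\<^sup>+y\<in>R. h y \<partial>lebesgue) / ennreal V + ennreal (l / 2)"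
    using R(3) V l by (simp flip: ennreal_plus)
  then have "ennreal (l / 2) < (\<integral>\<^sup>+y\<in>R. h y \<partial>lebesgue) / emeasure lebesgue R"
    unfolding V(2) by (metis add_mono_thms_linordered_semiring(3) not_le)
  then show ?thesis unfolding less_maximal_operator_iff h_def using R by blast
qed

text \<open>For finite \<open>y\<close> this is the integral of the derivative of a power. For
  infinite \<open>y\<close> the layers contain every bounded interval starting at 0, so the integral
  exceeds every real number.\<close>

lemma ennreal_powr_le_layers:
  assumes p: "0 < p"
  shows "ennreal_powr y p \<le> (\<integral>\<^sup>+l. ennreal (p * l powr (p - 1)) * indicator {l. 0 < l \<and> ennreal l < y} l \<partial>lborel)"
    (is "_ \<le> ?I")
proof (cases y)
  case (real c)
  then have "{l. 0 < l \<and> ennreal l < y} = {0<..<c}" by (auto simp: ennreal_less_iff)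
  then show ?thesis using nn_integral_powr_from_0[OF p real(1)] real by (simp add: ennreal_powr_def)
next
  case top
  have *: "ennreal r \<le> ?I" if "0 \<le> r" for r
  proof -
    have "ennreal r = (\<integral>\<^sup>+l. ennreal (p * l powr (p - 1)) * indicator {0<..<r powr (1 / p)} l \<partial>lborel)"
      using p that by (subst nn_integral_powr_from_0) (auto simp: powr_powr)
    also have "\<dots> \<le> ?I" using top by (intro nn_integral_mono) (auto split: split_indicator)
    finally show ?thesis .
  qed
  have "?I = \<infinity>"
  proof (cases ?I)
    case (real s)
    then have "ennreal (s + 1) \<le> ennreal s" using *[of "s + 1"] by simp
    then show ?thesis using real(1) by (subst (asm) ennreal_le_iff) auto
  qed simp
  then show ?thesis by simp
qed

text \<open>The weak bound at level \<open>l / 2\<close> costs two powers of \<open>l\<close>,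
  leaving \<open>l powr (p - 3)\<close> on the range from 0 to \<open>2 * \<gamma> x\<close>. This
  is integrable at 0 because \<open>p\<close> exceeds 2. Its integral supplies \<open>p - 2\<close>
  powers of \<open>\<gamma> x\<close>, to be added to the two already present, and the factor
  \<open>2 powr (p - 2) / (p - 2)\<close>.\<close>

lemma directional_maximal_strong_type:
  fixes \<gamma> :: "real^2 \<Rightarrow> real" and w :: "real^2 \<Rightarrow> ennreal" and p :: real
  assumes N: "N > 0" and p: "2 < p"
    and [measurable]: "\<gamma> \<in> borel_measurable lebesgue" "w \<in> borel_measurable lebesgue"
    and \<gamma>: "\<And>x. 0 \<le> \<gamma> x"
  defines "K \<equiv> 583200 * (real (scale_count N) + 1)"
  shows "(\<integral>\<^sup>+x. ennreal_powr (directional_maximal (uniform_directions N) (\<lambda>y. ennreal (\<gamma> y)) x) p * w x \<partial>lebesgue)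
    \<le> ennreal (K * (4 * p * 2 powr (p - 2) / (p - 2))) *
      (\<integral>\<^sup>+x. ennreal_powr (ennreal (\<gamma> x)) p * directional_maximal (uniform_directions N) (hl_maximal w) x \<partial>lebesgue)"
proof -
  define M where "M = directional_maximal (uniform_directions N) (\<lambda>y. ennreal (\<gamma> y))"
  define W where "W = directional_maximal (uniform_directions N) (hl_maximal w)"
  have [measurable]: "M \<in> borel_measurable lebesgue" "W \<in> borel_measurable lebesgue"
    unfolding M_def W_def by (intro directional_maximal_measurable norm_uniform_directions; assumption)+
  have K: "0 < K" by (simp add: K_def)
  interpret pair_sigma_finite "lborel :: real measure" "lebesgue :: (real^2) measure"
    by (intro pair_sigma_finite.intro lborel.sigma_finite_measure_axioms sigma_finite_lebesgue)
  have "(\<integral>\<^sup>+x. ennreal_powr (M x) p * w x \<partial>lebesgue)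
      \<le> (\<integral>\<^sup>+x. (\<integral>\<^sup>+l. ennreal (p * l powr (p - 1)) * indicator {l. 0 < l \<and> ennreal l < M x} l \<partial>lborel) * w x \<partial>lebesgue)"
    using p by (intro nn_integral_mono mult_right_mono ennreal_powr_le_layers) auto
  also have "\<dots> = (\<integral>\<^sup>+x. (\<integral>\<^sup>+l. (if 0 < l \<and> ennreal l < M x then ennreal (p * l powr (p - 1)) * w x else 0) \<partial>lborel) \<partial>lebesgue)"
    by (subst nn_integral_multc[symmetric])
      (auto intro!: nn_integral_cong split: split_indicator)
  also have "\<dots> = (\<integral>\<^sup>+l. (\<integral>\<^sup>+x. (if 0 < l \<and> ennreal l < M x then ennreal (p * l powr (p - 1)) * w x else 0) \<partial>lebesgue) \<partial>lborel)"
    by (rule Fubini') measurable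
  also have "\<dots> \<le> (\<integral>\<^sup>+l. (\<integral>\<^sup>+x. (if 0 < l \<and> l < 2 * \<gamma> x then ennreal (K * (4 * p) * l powr (p - 3)) * (ennreal ((\<gamma> x)\<^sup>2) * W x) else 0) \<partial>lebesgue) \<partial>lborel)"
  proof (rule nn_integral_mono)
    fix l :: real
    show "(\<integral>\<^sup>+x. (if 0 < l \<and> ennreal l < M x then ennreal (p * l powr (p - 1)) * w x else 0) \<partial>lebesgue)
      \<le> (\<integral>\<^sup>+x. (if 0 < l \<and> l < 2 * \<gamma> x then ennreal (K * (4 * p) * l powr (p - 3)) * (ennreal ((\<gamma> x)\<^sup>2) * W x) else 0) \<partial>lebesgue)"
    proof (cases "0 < l")
      case l: True
      define h where "h y = ennreal (\<gamma> y) * indicator {y. ennreal (l / 2) < ennreal (\<gamma> y)} y" for y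
      have [measurable]: "h \<in> borel_measurable lebesgue" unfolding h_def by measurable
      define E where "E = {x. ennreal (l / 2) < directional_maximal (uniform_directions N) h x}"
      have "directional_maximal (uniform_directions N) h \<in> borel_measurable lebesgue"
        by (intro directional_maximal_measurable norm_uniform_directions)
      then have [measurable]: "E \<in> sets lebesgue"
        using measurable_sets[of "directional_maximal (uniform_directions N) h" lebesgue borel "{ennreal (l / 2)<..}"]
        by (simp add: E_def vimage_def)
      have ME: "x \<in> E" if "ennreal l < M x" for x
        using maximal_operator_split_level[OF dilation_closed_directional[of "uniform_directions N"] l, of "\<lambda>y. ennreal (\<gamma> y)" x]
          norm_uniform_directions that unfolding E_def M_def h_def directional_maximal_def by simp
      have "l powr (p - 1) = l powr (p - 3) * l\<^sup>2"
        using l powr_add[of l "p - 3" 2] by (simp add: powr_numeral)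
      \<comment> \<open>Splits off the square of the level at which the weak type bound is
        applied.\<close>
      then have pw: "p * l powr (p - 1) = 4 * p * l powr (p - 3) * (l / 2)\<^sup>2" by (simp add: power_divide)
      have "(\<integral>\<^sup>+x. (if 0 < l \<and> ennreal l < M x then ennreal (p * l powr (p - 1)) * w x else 0) \<partial>lebesgue)
          \<le> (\<integral>\<^sup>+x. ennreal (p * l powr (p - 1)) * (w x * indicator E x) \<partial>lebesgue)"
        using ME by (intro nn_integral_mono) auto
      also have "\<dots> = ennreal (p * l powr (p - 1)) * (\<integral>\<^sup>+x\<in>E. w x \<partial>lebesgue)"
        by (rule nn_integral_cmult) measurable
      also have "\<dots> = ennreal (4 * p * l powr (p - 3)) * (ennreal ((l / 2)\<^sup>2) * (\<integral>\<^sup>+x\<in>E. w x \<partial>lebesgue))"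
        unfolding pw using p l by (subst ennreal_mult) (auto simp: mult.assoc)
      also have "\<dots> \<le> ennreal (4 * p * l powr (p - 3)) * (ennreal K * (\<integral>\<^sup>+x. (h x)\<^sup>2 * W x \<partial>lebesgue))"
        unfolding E_def K_def W_def using l
        by (intro mult_left_mono directional_maximal_weak_type N) (auto simp: h_def split: split_indicator)
      also have "\<dots> = ennreal (K * (4 * p) * l powr (p - 3)) * (\<integral>\<^sup>+x. (h x)\<^sup>2 * W x \<partial>lebesgue)"
        unfolding mult.assoc[symmetric] using K p l by (subst ennreal_mult[symmetric]) (auto simp: mult_ac)
      also have "\<dots> = (\<integral>\<^sup>+x. ennreal (K * (4 * p) * l powr (p - 3)) * ((h x)\<^sup>2 * W x) \<partial>lebesgue)"
        by (rule nn_integral_cmult[symmetric]) measurable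
      also have "\<dots> = (\<integral>\<^sup>+x. (if 0 < l \<and> l < 2 * \<gamma> x then ennreal (K * (4 * p) * l powr (p - 3)) * (ennreal ((\<gamma> x)\<^sup>2) * W x) else 0) \<partial>lebesgue)"
        using l \<gamma> by (intro nn_integral_cong)
          (auto simp: h_def ennreal_less_iff ennreal_power split: split_indicator)
      finally show ?thesis .
    qed simp
  qed
  also have "\<dots> = (\<integral>\<^sup>+x. (\<integral>\<^sup>+l. (if 0 < l \<and> l < 2 * \<gamma> x then ennreal (K * (4 * p) * l powr (p - 3)) * (ennreal ((\<gamma> x)\<^sup>2) * W x) else 0) \<partial>lborel) \<partial>lebesgue)"
    by (rule Fubini'[symmetric]) measurable
  also have "\<dots> = (\<integral>\<^sup>+x. ennreal (K * (4 * p * 2 powr (p - 2) / (p - 2))) * (ennreal_powr (ennreal (\<gamma> x)) p * W x) \<partial>lebesgue)"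
  proof (rule nn_integral_cong)
    fix x
    define D where "D = K * (4 * p) / (p - 2)"
    have D: "0 \<le> D" using K p by (simp add: D_def)
    have DD: "ennreal (K * (4 * p) * l powr (p - 3)) = ennreal D * ennreal ((p - 2) * l powr (p - 2 - 1))" for l
      using D p by (subst ennreal_mult[symmetric]) (auto simp: D_def mult.assoc)
    have "(\<integral>\<^sup>+l. (if 0 < l \<and> l < 2 * \<gamma> x then ennreal (K * (4 * p) * l powr (p - 3)) * (ennreal ((\<gamma> x)\<^sup>2) * W x) else 0) \<partial>lborel)
      = (\<integral>\<^sup>+l. ennreal D * (ennreal ((p - 2) * l powr (p - 2 - 1)) * indicator {0<..<2 * \<gamma> x} l) * (ennreal ((\<gamma> x)\<^sup>2) * W x) \<partial>lborel)"
      by (intro nn_integral_cong) (auto simp: DD split: split_indicator)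
    also have "\<dots> = ennreal D * ennreal ((2 * \<gamma> x) powr (p - 2)) * (ennreal ((\<gamma> x)\<^sup>2) * W x)"
      using p \<gamma>[of x]
      by (subst nn_integral_multc, measurable, subst nn_integral_cmult, measurable, subst nn_integral_powr_from_0) auto
    also have "\<dots> = ennreal (D * (2 * \<gamma> x) powr (p - 2) * (\<gamma> x)\<^sup>2) * W x"
      using D by (simp add: ennreal_mult mult.assoc)
    also have "D * (2 * \<gamma> x) powr (p - 2) * (\<gamma> x)\<^sup>2 = K * (4 * p * 2 powr (p - 2) / (p - 2)) * \<gamma> x powr p"
    proof (cases "\<gamma> x = 0")
      case False
      then have "\<gamma> x powr p = \<gamma> x powr (p - 2) * (\<gamma> x)\<^sup>2"
        using \<gamma>[of x] powr_add[of "\<gamma> x" "p - 2" 2] by (simp add: powr_numeral)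
      then show ?thesis using \<gamma>[of x] by (simp add: D_def powr_mult)
    qed (use p in auto)
    also have "ennreal \<dots> * W x = ennreal (K * (4 * p * 2 powr (p - 2) / (p - 2))) * (ennreal_powr (ennreal (\<gamma> x)) p * W x)"
      using K p \<gamma>[of x] by (subst ennreal_mult) (auto simp: ennreal_powr_def mult.assoc)
    finally show "(\<integral>\<^sup>+l. (if 0 < l \<and> l < 2 * \<gamma> x then ennreal (K * (4 * p) * l powr (p - 3)) * (ennreal ((\<gamma> x)\<^sup>2) * W x) else 0) \<partial>lborel)
      = ennreal (K * (4 * p * 2 powr (p - 2) / (p - 2))) * (ennreal_powr (ennreal (\<gamma> x)) p * W x)" .
  qed
  also have "\<dots> = ennreal (K * (4 * p * 2 powr (p - 2) / (p - 2))) * (\<integral>\<^sup>+x. ennreal_powr (ennreal (\<gamma> x)) p * W x \<partial>lebesgue)"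
  proof (rule nn_integral_cmult)
    have "ennreal_powr (ennreal (\<gamma> x)) p = ennreal (\<gamma> x powr p)" for x
      using \<gamma>[of x] by (simp add: ennreal_powr_def)
    then show "(\<lambda>x. ennreal_powr (ennreal (\<gamma> x)) p * W x) \<in> borel_measurable lebesgue"
      by (simp only:) measurable
  qed
  finally show ?thesis unfolding M_def W_def .
qed

section \<open>The logarithmic count and the norm inequality\<close>

text \<open>Counting exponents gives \<open>4 + log 2 N\<close>, and \<open>ln 2\<close> is at least
  1/2. The additive 4 is absorbed because \<open>N > 10\<close> forces \<open>ln N\<close> to be at
  least 1.\<close>

lemma scale_count_le_ln:
  assumes "N > 10"
  shows "real (scale_count N) + 1 \<le> 6 * ln (real N)"
proof -
  have "{m::nat. 2 ^ m \<le> 2 * real N} \<subseteq> {..nat \<lfloor>log 2 (2 * real N)\<rfloor>}"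
  proof
    fix m :: nat assume "m \<in> {m. 2 ^ m \<le> 2 * real N}"
    then have "log 2 (2 ^ m) \<le> log 2 (2 * real N)" using assms by (subst log_le_cancel_iff) auto
    then have "real m \<le> log 2 (2 * real N)" by (simp add: log_nat_power)
    then show "m \<in> {..nat \<lfloor>log 2 (2 * real N)\<rfloor>}" by (simp add: le_nat_floor)
  qed
  then have "card {m::nat. 2 ^ m \<le> 2 * real N} \<le> card {..nat \<lfloor>log 2 (2 * real N)\<rfloor>}"
    by (intro card_mono) auto
  then have "real (card {m::nat. 2 ^ m \<le> 2 * real N}) \<le> real (nat \<lfloor>log 2 (2 * real N)\<rfloor>) + 1"
    by simp
  also have "\<dots> \<le> log 2 (2 * real N) + 1"
    using assms by (intro add_mono) (auto simp: of_nat_floor)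
  also have "log 2 (2 * real N) = 1 + log 2 (real N)" using assms by (subst log_mult) auto
  also have "log 2 (real N) \<le> 2 * ln (real N)"
  proof -
    have "1 / 2 \<le> ln (2::real)" by (rule order_trans[OF _ ln2_ge_two_thirds]) simp
    then have "ln (real N) * 1 \<le> ln (real N) * (2 * ln 2)" using assms by (intro mult_left_mono) auto
    then show ?thesis by (simp add: log_def field_simps)
  qed
  finally have "real (scale_count N) + 1 \<le> 4 + 2 * ln (real N)" by (simp add: scale_count_def)
  moreover have "1 \<le> ln (real N)"
  proof -
    have "exp 1 \<le> real N" using exp_le assms by linarith
    then show ?thesis using assms by (subst ln_ge_iff) auto
  qed
  ultimately show ?thesis by linarith
qed

text \<open>Local integrability makes the restrictions to balls measurable, and \<open>w\<close> is
  their pointwise limit.\<close>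

lemma weight_measurable:
  assumes "weight w"
  shows "w \<in> borel_measurable lebesgue"
proof (rule borel_measurable_LIMSEQ_real)
  fix n :: nat
  have "set_integrable lebesgue (cball 0 (real n)) w" using assms by (auto simp: weight_def)
  then show "(\<lambda>x. indicator (cball 0 (real n)) x *\<^sub>R w x) \<in> borel_measurable lebesgue"
    unfolding set_integrable_def by (rule borel_measurable_integrable)
next
  fix x :: "real^2"
  obtain k :: nat where k: "norm x \<le> real k" using real_arch_simple by blast
  have "\<forall>\<^sub>F n in sequentially. indicator (cball 0 (real n)) x *\<^sub>R w x = w x"
    using eventually_ge_at_top[of k] by eventually_elim (use k in auto)
  then show "(\<lambda>n. indicator (cball 0 (real n)) x *\<^sub>R w x) \<longlonglongrightarrow> w x"
    by (rule tendsto_eventually)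
qed

lemma ennreal_powr_mono:
  assumes "0 < q" "x \<le> y"
  shows "ennreal_powr x q \<le> ennreal_powr y q"
proof (cases "y = \<infinity>")
  case False
  then have "x \<noteq> \<infinity>" using assms(2) by (auto simp: top_unique)
  then show ?thesis using False assms
    by (auto simp: ennreal_powr_def less_top intro!: ennreal_leI powr_mono2 enn2real_mono)
qed (simp add: ennreal_powr_def)

lemma ennreal_powr_cmult:
  assumes "0 < a"
  shows "ennreal_powr (ennreal a * y) q = ennreal (a powr q) * ennreal_powr y q"
proof (cases "y = \<infinity>")
  case True
  then show ?thesis using assms by (simp add: ennreal_powr_def ennreal_mult_top)
next
  case False
  then obtain b where "y = ennreal b" "0 \<le> b" by (cases y) auto
  then show ?thesis using assms by (simp add: ennreal_powr_def ennreal_mult[symmetric] powr_mult)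
qed

theorem corollary1p5:
  fixes p :: real
  assumes "2 < p"
  shows "\<exists>C::real. C > 0 \<and>
    (\<forall>(N::nat) (w :: real^2 \<Rightarrow> real) (W :: real^2 \<Rightarrow> ennreal) (f :: real^2 \<Rightarrow> complex).
      N > 10 \<longrightarrow> weight w \<longrightarrow>
      W = directional_maximal (uniform_directions N) (hl_maximal (\<lambda>y. ennreal (w y))) \<longrightarrow>
      f \<in> weighted_Lp p W \<longrightarrow>
      weighted_Lp_norm p (\<lambda>x. ennreal (w x))
        (directional_maximal (uniform_directions N) (\<lambda>y. ennreal (cmod (f y))))
      \<le> ennreal (C * (ln (real N)) powr (1 / p))
          * weighted_Lp_norm p W (\<lambda>x. ennreal (cmod (f x))))"
proof -
  \<comment> \<open>The 6 bounds the scale count by \<open>ln N\<close>; the other factors are those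
    of the strong type estimate. The constant of the theorem is the \<open>p\<close>-th root, since
    the estimate is for \<open>p\<close>-th powers of norms.\<close>
  define D where "D = 583200 * 6 * (4 * p * 2 powr (p - 2) / (p - 2))"
  have D: "0 < D" using assms by (simp add: D_def)
  show ?thesis
  proof (intro exI[of _ "D powr (1 / p)"] conjI allI impI)
    show "0 < D powr (1 / p)" using D by simp
  next
    fix N :: nat and w :: "real^2 \<Rightarrow> real" and W :: "real^2 \<Rightarrow> ennreal" and f :: "real^2 \<Rightarrow> complex"
    assume N: "10 < N" and w: "weight w"
      and W: "W = directional_maximal (uniform_directions N) (hl_maximal (\<lambda>y. ennreal (w y)))"
      and f: "f \<in> weighted_Lp p W"
    define J where "J = (\<integral>\<^sup>+x. ennreal_powr (ennreal (cmod (f x))) p * W x \<partial>lebesgue)"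
    have [measurable]: "w \<in> borel_measurable lebesgue" using weight_measurable[OF w] .
    have [measurable]: "f \<in> borel_measurable lebesgue" using f by (simp add: weighted_Lp_def)
    have lnN: "0 < ln (real N)" using N by simp
    have E: "0 \<le> 4 * p * 2 powr (p - 2) / (p - 2)" using assms by simp
    have "(\<integral>\<^sup>+x. ennreal_powr (directional_maximal (uniform_directions N) (\<lambda>y. ennreal (cmod (f y))) x) p
        * ennreal (w x) \<partial>lebesgue)
      \<le> ennreal (583200 * (real (scale_count N) + 1) * (4 * p * 2 powr (p - 2) / (p - 2))) * J"
      unfolding J_def W using N assms by (intro directional_maximal_strong_type) auto
    also have "\<dots> \<le> ennreal (D * ln (real N)) * J"
    proof (intro mult_right_mono ennreal_leI)
      have "583200 * (real (scale_count N) + 1) * (4 * p * 2 powr (p - 2) / (p - 2))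
          \<le> 583200 * (6 * ln (real N)) * (4 * p * 2 powr (p - 2) / (p - 2))"
        using scale_count_le_ln[OF N] by (intro mult_right_mono E) simp
      then show "583200 * (real (scale_count N) + 1) * (4 * p * 2 powr (p - 2) / (p - 2)) \<le> D * ln (real N)"
        by (simp add: D_def mult_ac)
    qed simp
    finally have "weighted_Lp_norm p (\<lambda>x. ennreal (w x))
        (directional_maximal (uniform_directions N) (\<lambda>y. ennreal (cmod (f y))))
      \<le> ennreal_powr (ennreal (D * ln (real N)) * J) (1 / p)"
      unfolding weighted_Lp_norm_def using assms by (intro ennreal_powr_mono) auto
    also have "\<dots> = ennreal (D powr (1 / p) * ln (real N) powr (1 / p)) * ennreal_powr J (1 / p)"
      using D lnN by (simp add: ennreal_powr_cmult powr_mult)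
    finally show "weighted_Lp_norm p (\<lambda>x. ennreal (w x))
        (directional_maximal (uniform_directions N) (\<lambda>y. ennreal (cmod (f y))))
      \<le> ennreal (D powr (1 / p) * ln (real N) powr (1 / p)) * weighted_Lp_norm p W (\<lambda>x. ennreal (cmod (f x)))"
      by (simp add: weighted_Lp_norm_def J_def)
  qed
qed

end
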